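(* Let $R>0$ and $\mu\in\mathbb{R}$ with $\mu R\le 3/2$. Let $f\in C_c^\infty(D_R)$ and $n\in\mathbb{Z}$, and let $f_n$ and $g_n$ denote the $n$-th angular Fourier coefficients of $f$ and of the attenuated V-line transform $\mathcal{V}_\mu f$, respectively. Then $f_n$ (restricted to $[0,R]$) is the unique solution $h$, among continuous functions $h:[0,R]\to\mathbb{C}$, of the integral equation $$\forall\,\psi\in(0,\pi/2):\quad g_n(\psi)=2\,e^{-\mu R\cos(\psi)}\int_{R\sin(\psi)}^{R} h(r)\,\frac{r\,K_n(R\sin(\psi),r)}{\sqrt{r^2-R^2\sin(\psi)^2}}\,\mathrm{d}r,$$ where $$K_n(s,r):=\sum_{\sigma=\pm1}\sigma^n\,e^{\sigma\mu\sqrt{r^2-s^2}}\,\cos\Bigl(n\bigl(\arcsin(\tfrac{s}{r})-\sigma\arcsin(\tfrac{s}{R})\bigr)\Bigr).$$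
   Context: $D_R:=\{x\in\mathbb{R}^2 : \|x\|<R\}$ is the open disc of radius $R$, and $C_c^\infty(D_R)$ is the set of all smooth functions $f:\mathbb{R}^2\to\mathbb{R}$ with $\operatorname{supp}(f)\subseteq D_R$. For $\varphi\in\mathbb{R}$, $\Phi(\varphi):=(\cos\varphi,\sin\varphi)$. The attenuated V-line transform $\mathcal{V}_\mu f:[0,2\pi)\times(0,\pi/2)\to\mathbb{R}$ of $f\in C_c^\infty(D_R)$ with attenuation parameter $\mu\in\mathbb{R}$ is $$\mathcal{V}_\mu f(\varphi,\psi):=\sum_{\sigma=\pm1}\int_0^\infty f\bigl(R\,\Phi(\varphi)-r\,\Phi(\varphi-\sigma\psi)\bigr)\,e^{-\mu r}\,\mathrm{d}r.$$ The Fourier coefficients are (with $\mathsf{i}$ the imaginary unit) $$f_n(r):=\frac{1}{2\pi}\int_0^{2\pi}f(r\Phi(\varphi))\,e^{-\mathsf{i}n\varphi}\,\mathrm{d}\varphi,\qquad g_n(\psi):=\frac{1}{2\pi}\int_0^{2\pi}(\mathcal{V}_\mu f)(\varphi,\psi)\,e^{-\mathsf{i}n\varphi}\,\mathrm{d}\varphi.$$ *)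

theory Defs
  imports "HOL-Analysis.Analysis"
begin

primrec C_k :: "nat \<Rightarrow> (real ^ 2 \<Rightarrow> real) \<Rightarrow> bool" where
  "C_k 0 f \<longleftrightarrow> continuous_on UNIV f"
| "C_k (Suc k) f \<longleftrightarrow>
     (\<forall>x. f differentiable (at x)) \<and> (\<forall>v. C_k k (\<lambda>x. frechet_derivative f (at x) v))"

definition smooth :: "(real ^ 2 \<Rightarrow> real) \<Rightarrow> bool" where
  "smooth f \<longleftrightarrow> (\<forall>k. C_k k f)"

text \<open>A closed set contained in the open disc is compact, so the support condition below already
  says that the support is compact.\<close>
definition Cc_inf_disc :: "real \<Rightarrow> (real ^ 2 \<Rightarrow> real) set" where
  "Cc_inf_disc R = {f. smooth f \<and> closure {x. f x \<noteq> 0} \<subseteq> ball 0 R}"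

definition unit_dir :: "real \<Rightarrow> real ^ 2" where
  "unit_dir \<phi> = vector [cos \<phi>, sin \<phi>]"

text \<open>Total in both angles; only the values on \<open>[0, 2\<pi>) \<times> (0, \<pi>/2)\<close> are meant.\<close>
definition v_line :: "real \<Rightarrow> real \<Rightarrow> (real ^ 2 \<Rightarrow> real) \<Rightarrow> real \<Rightarrow> real \<Rightarrow> real" where
  "v_line R \<mu> f \<phi> \<psi> = (\<Sum>\<sigma>\<in>{1, - 1}.
     LBINT r:{0..}. f (R *\<^sub>R unit_dir \<phi> - r *\<^sub>R unit_dir (\<phi> - \<sigma> * \<psi>)) * exp (- \<mu> * r))"

definition fourier_coeff :: "int \<Rightarrow> (real \<Rightarrow> real) \<Rightarrow> complex" where
  "fourier_coeff n u = 1 / (2 * pi) *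
     (LBINT \<phi>:{0..2 * pi}. complex_of_real (u \<phi>) * exp (- \<i> * of_int n * complex_of_real \<phi>))"

definition f_coeff :: "(real ^ 2 \<Rightarrow> real) \<Rightarrow> int \<Rightarrow> real \<Rightarrow> complex" where
  "f_coeff f n r = fourier_coeff n (\<lambda>\<phi>. f (r *\<^sub>R unit_dir \<phi>))"

definition g_coeff :: "real \<Rightarrow> real \<Rightarrow> (real ^ 2 \<Rightarrow> real) \<Rightarrow> int \<Rightarrow> real \<Rightarrow> complex" where
  "g_coeff R \<mu> f n \<psi> = fourier_coeff n (\<lambda>\<phi>. v_line R \<mu> f \<phi> \<psi>)"

definition kernel_K :: "real \<Rightarrow> real \<Rightarrow> int \<Rightarrow> real \<Rightarrow> real \<Rightarrow> real" where
  "kernel_K R \<mu> n s r = (\<Sum>\<sigma>\<in>{1, - 1}.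
     \<sigma> powi n * exp (\<sigma> * \<mu> * sqrt (r\<^sup>2 - s\<^sup>2)) *
     cos (of_int n * (arcsin (s / r) - \<sigma> * arcsin (s / R))))"

text \<open>For continuous \<open>h\<close> the integrand is absolutely integrable, so the Lebesgue integral
  is the intended (improper) integral.\<close>
definition solves_integral_eq ::
    "real \<Rightarrow> real \<Rightarrow> int \<Rightarrow> (real \<Rightarrow> complex) \<Rightarrow> (real \<Rightarrow> complex) \<Rightarrow> bool" where
  "solves_integral_eq R \<mu> n g h \<longleftrightarrow> (\<forall>\<psi>\<in>{0<..<pi/2}.
     g \<psi> = 2 * complex_of_real (exp (- \<mu> * R * cos \<psi>)) *
       (LBINT r:{R * sin \<psi>..R}.
          h r * complex_of_real (r * kernel_K R \<mu> n (R * sin \<psi>) r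
                                  / sqrt (r\<^sup>2 - R\<^sup>2 * (sin \<psi>)\<^sup>2))))"

end

theory Submission
  imports Defs
begin

text \<open>
  \<^emph>\<open>The equation holds.\<close>  Both branches of the V-line through \<open>R \<Phi>(\<phi>)\<close> are chords at distance
  \<open>s = R sin \<psi>\<close> from the origin.  The point at signed distance \<open>\<tau>\<close> from the foot of the
  perpendicular has radius \<open>sqrt (s\<^sup>2 + \<tau>\<^sup>2)\<close> and an angle \<open>\<phi> + \<sigma> \<alpha>(\<tau>)\<close> in which \<open>\<phi>\<close> enters only
  as a shift (\<open>chord_point_polar\<close>).  After exchanging the integrals, the \<open>n\<close>-th Fourier
  coefficient in \<open>\<phi>\<close> therefore just multiplies \<open>f\<^sub>n\<close> by \<open>exp (i n \<sigma> \<alpha>(\<tau>))\<close>; adding the two branches,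
  folding \<open>\<tau>\<close> and \<open>- \<tau>\<close> together and substituting \<open>r = sqrt (s\<^sup>2 + \<tau>\<^sup>2)\<close> gives the kernel
  (\<open>g_coeff_chord_integral\<close>, \<open>complex_kernel_integral_chord\<close>).

  \<^emph>\<open>The solution is unique.\<close>  The real and imaginary parts \<open>d\<close> of the difference of two solutions
  solve the homogeneous equation, which is of Abel type in the variable \<open>r\<^sup>2\<close>.  Suppose \<open>d\<close> vanishes
  beyond \<open>s\<^sub>0\<close>, and put \<open>u = s\<^sub>0\<^sup>2 - s\<^sup>2\<close>, \<open>v = s\<^sub>0\<^sup>2 - r\<^sup>2\<close>, \<open>H(v) = d(r)\<close>, \<open>k(u, v) = K(s, r)\<close>, so that
  \<open>\<integral>\<^sub>0\<^sup>u H(v) k(u, v) / sqrt (u - v) dv = 0\<close>.  Integrating against \<open>1 / sqrt (x - u)\<close> removes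
  the singularity (\<open>abel_composition\<close>), and differentiating in \<open>x\<close> leaves, up to an error
  controlled by the variation of the derivative of \<open>k\<close> in \<open>u\<close>, the relation
  \<open>k(x, x) H(x) + (\<kappa> / 2) \<integral>\<^sub>0\<^sup>x H = 0\<close> with \<open>\<kappa> = \<partial>\<^sub>u k(0, 0)\<close> (\<open>abel_derivative_bound\<close>).

  On the diagonal \<open>K(s, s) = 2 cos (n arccos (s / R))\<close>.  Where this is nonzero, \<open>H\<close> vanishes near \<open>0\<close>
  by the usual Volterra argument.  It has zeros, however, and at a zero the relation
  degenerates to the Euler equation \<open>x H(x) + p \<integral>\<^sub>0\<^sup>x H = 0\<close> with \<open>p = \<kappa> / (2 c)\<close>,
  where \<open>c\<close> is the derivative of the diagonal.  Its solutions are \<open>\<integral>\<^sub>0\<^sup>x H = C x powr (- p)\<close>,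
  and since \<open>H\<close> is bounded, the left-hand side is \<open>O(x)\<close>, which for \<open>p > - 1\<close> forces \<open>C = 0\<close>.  A
  quantitative version of this observation (\<open>euler_inequality\<close>) absorbs the error term.  For the kernel at hand \<open>p = 1 / 2 - \<mu> sqrt (R\<^sup>2 - s\<^sub>0\<^sup>2)\<close>,
  and \<open>\<mu> R \<le> 3 / 2\<close> is what makes \<open>p > - 1\<close> at every zero \<open>s\<^sub>0 > 0\<close>.  Hence the
  vanishing of \<open>d\<close> always propagates to smaller radii.
\<close>

section \<open>Weakly singular integrals and the Abel composition\<close>

text \<open>
  The substitution \<open>u = v + (x - v) (1 - cos t) / 2\<close> of \<open>[0, \<pi>]\<close> onto \<open>[v, x]\<close> turns the arcsine
  density \<open>1 / (sqrt (u - v) sqrt (x - u))\<close> into the constant \<open>1\<close>.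
\<close>
lemma arcsine_substitution:
  fixes v x t :: real
  assumes "v < x" "0 < t" "t < pi"
  defines "u \<equiv> v + (x - v) * (1 - cos t) / 2"
  shows "sqrt (u - v) * sqrt (x - u) = (x - v) * sin t / 2"
    and "sin t > 0" and "v < u" and "u < x"
proof -
  show s: "sin t > 0" using assms by (simp add: sin_gt_zero)
  have c: "cos t < 1" "cos t > -1"
    using assms cos_monotone_0_pi[of 0 t] cos_monotone_0_pi[of t pi] by auto
  show "v < u" using c assms(1) by (simp add: u_def)
  have "x - u = (x - v) * (1 + cos t) / 2" by (simp add: u_def field_simps)
  moreover have "\<dots> > 0" using c assms(1) by simp
  ultimately show "u < x" by linarith
  have "(u - v) * (x - u) = (x - v)\<^sup>2 * (1 - (cos t)\<^sup>2) / 4"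
    by (simp add: u_def power2_eq_square field_simps)
  then have "(u - v) * (x - u) = ((x - v) * sin t / 2)\<^sup>2"
    by (simp add: sin_squared_eq[of t, symmetric] power_mult_distrib power_divide)
  then show "sqrt (u - v) * sqrt (x - u) = (x - v) * sin t / 2"
    using s assms(1) by (simp flip: real_sqrt_mult)
qed

lemma nn_integral_arcsine_density:
  fixes v x :: real
  assumes "v < x"
  shows "(\<integral>\<^sup>+u. ennreal (1 / (sqrt (u - v) * sqrt (x - u))) * indicator {v..x} u \<partial>lborel) = pi"
proof -
  define g where "g = (\<lambda>t::real. v + (x - v) * (1 - cos t) / 2)"
  have g: "g 0 = v" "g pi = x" by (auto simp: g_def field_simps)
  have "(\<integral>\<^sup>+u. ennreal (1 / (sqrt (u - v) * sqrt (x - u))) * indicator {v..x} u \<partial>lborel)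
      = (\<integral>\<^sup>+u. ennreal (1 / (sqrt (u - v) * sqrt (x - u)) * indicator {g 0..g pi} u) \<partial>lborel)"
    unfolding g by (rule nn_integral_cong) (auto split: split_indicator)
  also have "\<dots> = (\<integral>\<^sup>+t. ennreal (1 / (sqrt (g t - v) * sqrt (x - g t)) * ((x - v) * sin t / 2)
           * indicator {0..pi} t) \<partial>lborel)"
  proof (rule nn_integral_substitution)
    show "set_borel_measurable borel {g 0..g pi} (\<lambda>u. 1 / (sqrt (u - v) * sqrt (x - u)))"
      unfolding set_borel_measurable_def by measurable
    show "(g has_real_derivative (x - v) * sin t / 2) (at t)" for t
      unfolding g_def by (auto intro!: derivative_eq_intros)
    show "continuous_on {0..pi} (\<lambda>t. (x - v) * sin t / 2)"
      by (intro continuous_intros) auto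
    show "0 \<le> (x - v) * sin t / 2" if "t \<in> {0..pi}" for t
      using that assms by (simp add: sin_ge_zero)
  qed auto
  also have "\<dots> = (\<integral>\<^sup>+t. indicator {0..pi} t \<partial>lborel)"
  proof (rule nn_integral_cong_AE)
    have "AE t in lborel. t \<noteq> 0 \<and> t \<noteq> pi" using AE_lborel_singleton[of "0::real"] AE_lborel_singleton[of pi] by auto
    then show "AE t in lborel. ennreal (1 / (sqrt (g t - v) * sqrt (x - g t)) * ((x - v) * sin t / 2)
           * indicator {0..pi} t) = indicator {0..pi} t"
    proof eventually_elim
      case (elim t)
      show ?case
      proof (cases "t \<in> {0<..<pi}")
        case True
        note a = arcsine_substitution[OF assms, of t, folded g_def]
        have one: "1 / (sqrt (g t - v) * sqrt (x - g t)) * ((x - v) * sin t / 2) = 1"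
          using a True assms unfolding g_def by simp
        show ?thesis
          unfolding one using True by simp
      qed (use elim in auto)
    qed
  qed
  finally show ?thesis by simp
qed

lemma nn_integral_inverse_sqrt:
  fixes A B :: real
  assumes "A \<le> B"
  shows "(\<integral>\<^sup>+w. ennreal (1 / sqrt (w - A)) * indicator {A..B} w \<partial>lborel) \<le> 2 * sqrt (B - A)"
proof -
  define g where "g = (\<lambda>t::real. A + t\<^sup>2)"
  have g: "g 0 = A" "g (sqrt (B - A)) = B" using assms by (auto simp: g_def)
  have "(\<integral>\<^sup>+w. ennreal (1 / sqrt (w - A)) * indicator {A..B} w \<partial>lborel)
      = (\<integral>\<^sup>+w. ennreal (1 / sqrt (w - A) * indicator {g 0..g (sqrt (B - A))} w) \<partial>lborel)"
    unfolding g by (rule nn_integral_cong) (auto split: split_indicator)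
  also have "\<dots> = (\<integral>\<^sup>+t. ennreal (1 / sqrt (g t - A) * (2 * t) * indicator {0..sqrt (B - A)} t) \<partial>lborel)"
  proof (rule nn_integral_substitution[where f = "\<lambda>w. 1 / sqrt (w - A)"])
    show "set_borel_measurable borel {g 0..g (sqrt (B - A))} (\<lambda>w. 1 / sqrt (w - A))"
      unfolding set_borel_measurable_def by measurable
    show "(g has_real_derivative 2 * t) (at t)" for t
      unfolding g_def by (auto intro!: derivative_eq_intros)
    show "continuous_on {0..sqrt (B - A)} (\<lambda>t. 2 * t)" by (intro continuous_intros)
  qed (use assms in auto)
  also have "\<dots> \<le> (\<integral>\<^sup>+t. 2 * indicator {0..sqrt (B - A)} t \<partial>lborel)"
    by (rule nn_integral_mono) (auto simp: g_def real_sqrt_abs split: split_indicator)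
  also have "\<dots> = 2 * sqrt (B - A)"
    using assms by (simp add: nn_integral_cmult ennreal_mult)
  finally show ?thesis by simp
qed

lemma set_integrable_weakly_singular:
  fixes q :: "real \<Rightarrow> 'a::euclidean_space"
  assumes "continuous_on {A..B} q"
  shows "set_integrable lborel {A..B} (\<lambda>w. q w /\<^sub>R sqrt (w - A))"
proof (cases "A \<le> B")
  case True
  obtain C where C: "\<And>w. w \<in> {A..B} \<Longrightarrow> norm (q w) \<le> C"
    using compact_continuous_image[OF assms] by (metis compact_Icc compact_imp_bounded bounded_iff imageI)
  have C0: "C \<ge> 0" using C[of A] True norm_ge_zero order_trans by (metis atLeastAtMost_iff order_refl)
  have i: "integrable lborel (\<lambda>w. indicator {A..B} w *\<^sub>R (1 / sqrt (w - A)))"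
  proof (rule integrableI_bounded)
    have "(\<integral>\<^sup>+w. ennreal (norm (indicator {A..B} w *\<^sub>R (1 / sqrt (w - A)))) \<partial>lborel)
        = (\<integral>\<^sup>+w. ennreal (1 / sqrt (w - A)) * indicator {A..B} w \<partial>lborel)"
      by (rule nn_integral_cong) (auto split: split_indicator)
    also have "\<dots> \<le> ennreal (2 * sqrt (B - A))" using nn_integral_inverse_sqrt[OF True] by simp
    finally show "(\<integral>\<^sup>+w. ennreal (norm (indicator {A..B} w *\<^sub>R (1 / sqrt (w - A)))) \<partial>lborel) < \<infinity>"
      using ennreal_less_top order_le_less_trans by (metis infinity_ennreal_def)
  qed measurable
  have m: "(\<lambda>w. indicator {A..B} w *\<^sub>R q w) \<in> borel_measurable borel"
    using borel_measurable_continuous_on_indicator[OF _ assms] by simp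
  have m': "(\<lambda>w. (indicator {A..B} w *\<^sub>R q w) /\<^sub>R sqrt (w - A)) \<in> borel_measurable lborel"
    using m by measurable
  have "integrable lborel (\<lambda>w. (indicator {A..B} w *\<^sub>R q w) /\<^sub>R sqrt (w - A))"
  proof (rule Bochner_Integration.integrable_bound[OF integrable_mult_right[OF i, of C] m'])
    show "AE w in lborel. norm ((indicator {A..B} w *\<^sub>R q w) /\<^sub>R sqrt (w - A))
         \<le> norm (C * indicator {A..B} w *\<^sub>R (1 / sqrt (w - A)))"
      using C C0 by (intro AE_I2) (auto split: split_indicator simp: divide_simps abs_mult)
  qed
  then show ?thesis unfolding set_integrable_def by (simp add: mult.commute)
qed (simp add: set_integrable_def)

lemma versine_between:
  fixes v x t :: real
  assumes "v \<le> x"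
  shows "v \<le> v + (x - v) * (1 - cos t) / 2" and "v + (x - v) * (1 - cos t) / 2 \<le> x"
proof -
  have "(x - v) * (1 - cos t) \<ge> 0" using assms by simp
  moreover have "(x - v) * (1 - cos t) \<le> (x - v) * 2" using assms by (intro mult_left_mono) auto
  ultimately show "v \<le> v + (x - v) * (1 - cos t) / 2" and "v + (x - v) * (1 - cos t) / 2 \<le> x"
    by (simp_all add: field_simps)
qed

lemma continuous_on_versine_average:
  fixes A :: "real \<Rightarrow> real \<Rightarrow> real"
  assumes cont: "continuous_on {(v, u). 0 \<le> v \<and> v \<le> u \<and> u \<le> x} (\<lambda>(v, u). A v u)"
  shows "continuous_on ({0..x} \<times> cbox 0 pi) (\<lambda>(v,t). A v (v + (x - v) * (1 - cos t) / 2))"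
proof -
  have "continuous_on ({0..x} \<times> cbox 0 pi)
      (\<lambda>z. (\<lambda>(v,u). A v u) (fst z, fst z + (x - fst z) * (1 - cos (snd z)) / 2))"
  proof (rule continuous_on_compose2[OF cont])
    show "continuous_on ({0..x} \<times> cbox 0 pi) (\<lambda>z. (fst z, fst z + (x - fst z) * (1 - cos (snd z)) / 2))"
      by (intro continuous_intros) auto
    show "(\<lambda>z. (fst z, fst z + (x - fst z) * (1 - cos (snd z)) / 2)) ` ({0..x} \<times> cbox 0 pi)
        \<subseteq> {(v, u). 0 \<le> v \<and> v \<le> u \<and> u \<le> x}"
      using versine_between by auto
  qed
  then show ?thesis by (simp add: case_prod_unfold)
qed

text \<open>
  Abel's trick: the singular equation is integrated against \<open>1 / sqrt (x - u)\<close>, and the order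
  of integration is exchanged.  The inner integral then carries the arcsine density,
  so that what remains is a weighted average of \<open>A v\<close> over \<open>[v, x]\<close>, free of singularities.
\<close>
lemma abel_composition:
  fixes A :: "real \<Rightarrow> real \<Rightarrow> real"
  assumes x: "0 < x"
    and cont: "continuous_on {(v, u). 0 \<le> v \<and> v \<le> u \<and> u \<le> x} (\<lambda>(v, u). A v u)"
    and eq: "\<And>u. 0 < u \<Longrightarrow> u < x \<Longrightarrow> (LBINT v:{0..u}. A v u / sqrt (u - v)) = 0"
  shows "integral {0..x} (\<lambda>v. integral {0..pi} (\<lambda>t. A v (v + (x - v) * (1 - cos t) / 2))) = 0"
proof -
  define T where "T = {(v, u). 0 \<le> v \<and> v \<le> u \<and> u \<le> (x::real)}"
  have T_eq: "T = {z. 0 \<le> fst z} \<inter> {z. fst z \<le> snd z} \<inter> {z. snd z \<le> x}" by (auto simp: T_def)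
  have closedT: "closed T" unfolding T_eq
    by (intro closed_Int closed_Collect_le continuous_intros)
  have Tsub: "T \<subseteq> {0..x} \<times> {0..x}" by (auto simp: T_def)
  have compT: "compact T"
    using compact_Int_closed[OF compact_Times[OF compact_Icc compact_Icc] closedT, of 0 x 0 x] Tsub
    by (metis inf.absorb_iff2)
  obtain C where C: "\<And>z. z \<in> T \<Longrightarrow> norm ((\<lambda>(v,u). A v u) z) \<le> C"
    using compact_continuous_image[OF cont[folded T_def] compT]
    by (metis compact_imp_bounded bounded_iff imageI)
  have C': "\<bar>A v u\<bar> \<le> C" if "0 \<le> v" "v \<le> u" "u \<le> x" for v u
    using C[of "(v,u)"] that by (auto simp: T_def)
  have C0: "C \<ge> 0" using C'[of 0 0] x by auto
  \<comment> \<open>The double integrand, cut off to the triangle so that both iterated integrals run over the whole line.\<close>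
  define P where "P = (\<lambda>z::real\<times>real. (indicator T z *\<^sub>R (\<lambda>(v,u). A v u) z)
      * (1 / (sqrt (snd z - fst z) * sqrt (x - snd z))))"
  have "(\<lambda>z. indicator T z *\<^sub>R (\<lambda>(v,u). A v u) z) \<in> borel_measurable borel"
    using borel_measurable_continuous_on_indicator[OF _ cont[folded T_def]] closedT by auto
  then have m1: "(\<lambda>z. indicator T z *\<^sub>R (\<lambda>(v,u). A v u) z) \<in> borel_measurable (lborel \<Otimes>\<^sub>M lborel)"
    by (simp add: lborel_prod)
  have Pm[measurable]: "P \<in> borel_measurable (lborel \<Otimes>\<^sub>M lborel)"
    unfolding P_def by (intro borel_measurable_times m1) measurable
  have bound: "ennreal (norm (P (v,u))) \<le> C * (ennreal (1 / (sqrt (u - v) * sqrt (x - u))) * indicator {v..x} u) * indicator {0..x} v" for v u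
    using C'[of v u] C0
    by (auto simp: P_def T_def abs_mult ennreal_mult'[symmetric] intro!: ennreal_leI divide_right_mono split: split_indicator)
  have "(\<integral>\<^sup>+u. ennreal (norm (P (v,u))) \<partial>lborel) \<le> ennreal (C * pi) * indicator {0..x} v" if "v \<noteq> x" for v
  proof -
    have "(\<integral>\<^sup>+u. ennreal (norm (P (v,u))) \<partial>lborel)
       \<le> (\<integral>\<^sup>+u. C * (ennreal (1 / (sqrt (u - v) * sqrt (x - u))) * indicator {v..x} u) * indicator {0..x} v \<partial>lborel)"
      by (rule nn_integral_mono) (rule bound)
    also have "\<dots> = C * (\<integral>\<^sup>+u. ennreal (1 / (sqrt (u - v) * sqrt (x - u))) * indicator {v..x} u \<partial>lborel) * indicator {0..x} v"
      by (subst nn_integral_multc, measurable, subst nn_integral_cmult, measurable)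
    also have "\<dots> \<le> ennreal (C * pi) * indicator {0..x} v"
      using nn_integral_arcsine_density[of v x] that C0 by (auto simp: ennreal_mult split: split_indicator)
    finally show ?thesis .
  qed
  note inner = this
  have Pint: "integrable (lborel \<Otimes>\<^sub>M lborel) P"
  proof (rule integrableI_bounded[OF Pm])
    have "(\<integral>\<^sup>+z. ennreal (norm (P z)) \<partial>(lborel \<Otimes>\<^sub>M lborel)) = (\<integral>\<^sup>+v. \<integral>\<^sup>+u. ennreal (norm (P (v,u))) \<partial>lborel \<partial>lborel)"
      by (subst lborel.nn_integral_fst[symmetric]) auto
    also have "\<dots> \<le> (\<integral>\<^sup>+v. ennreal (C * pi) * indicator {0..x} v \<partial>lborel)"
      by (rule nn_integral_mono_AE) (use AE_lborel_singleton[of x] in \<open>eventually_elim, use inner in auto\<close>)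
    also have "\<dots> = ennreal (C * pi) * emeasure lborel {0..x}"
      by (simp add: nn_integral_cmult_indicator)
    also have "\<dots> < \<infinity>" using x by (simp add: ennreal_mult[symmetric] ennreal_mult_less_top)
    finally show "(\<integral>\<^sup>+z. ennreal (norm (P z)) \<partial>(lborel \<Otimes>\<^sub>M lborel)) < \<infinity>" .
  qed
  have Pint': "integrable (lborel \<Otimes>\<^sub>M lborel) (\<lambda>(v,u). P (v,u))" using Pint by simp
  have left: "(\<integral>v. P (v,u) \<partial>lborel) = 0" if "u \<noteq> 0" "u \<noteq> x" for u
  proof (cases "0 < u \<and> u < x")
    case True
    have "(\<integral>v. P (v,u) \<partial>lborel) = (\<integral>v. (indicator {0..u} v *\<^sub>R (A v u / sqrt (u - v))) * (1 / sqrt (x - u)) \<partial>lborel)"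
      using True by (intro Bochner_Integration.integral_cong) (auto simp: P_def T_def split: split_indicator)
    also have "\<dots> = (LBINT v:{0..u}. A v u / sqrt (u - v)) * (1 / sqrt (x - u))"
      unfolding set_lebesgue_integral_def by (rule integral_mult_left_zero)
    finally show ?thesis using eq True by simp
  next
    case False
    then have "P (v,u) = 0" for v using that by (auto simp: P_def T_def split: split_indicator)
    then show ?thesis by simp
  qed
  define G where "G = (\<lambda>v. integral {0..pi} (\<lambda>t. A v (v + (x - v) * (1 - cos t) / 2)))"
  have cont2: "continuous_on ({0..x} \<times> cbox 0 pi) (\<lambda>(v,t). A v (v + (x - v) * (1 - cos t) / 2))"
    by (rule continuous_on_versine_average[OF cont])
  have contG: "continuous_on {0..x} G"
    using integral_continuous_on_param[OF cont2] by (simp add: G_def)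
  have right: "(\<integral>u. P (v,u) \<partial>lborel) = indicator {0..x} v *\<^sub>R G v" if "v \<noteq> x" for v
  proof (cases "0 \<le> v \<and> v < x")
    case True
    define g where "g = (\<lambda>t::real. v + (x - v) * (1 - cos t) / 2)"
    have g: "g 0 = v" "g pi = x" by (auto simp: g_def field_simps)
    have cA: "continuous_on {0..pi} (\<lambda>t. A v (g t))"
    proof -
      have "continuous_on {0..pi} (\<lambda>t. (\<lambda>(v,t). A v (v + (x - v) * (1 - cos t) / 2)) (v, t))"
        using True by (intro continuous_on_compose2[OF cont2] continuous_intros) auto
      then show ?thesis by (simp add: g_def)
    qed
    define F where "F = (\<lambda>u. A v u * (1 / (sqrt (u - v) * sqrt (x - u))))"
    have PF: "P (v,u) = indicator {v..x} u *\<^sub>R F u" for u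
      using True by (auto simp: P_def F_def T_def split: split_indicator)
    have "integrable lborel (\<lambda>u. P (v,u))"
    proof (rule integrableI_bounded)
      show "(\<lambda>u. P (v, u)) \<in> borel_measurable lborel" by measurable
      show "(\<integral>\<^sup>+u. ennreal (norm (P (v,u))) \<partial>lborel) < \<infinity>"
        using inner[OF that] by (rule order_le_less_trans) (auto split: split_indicator simp: ennreal_mult[symmetric] C0)
    qed
    then have si: "set_integrable lborel {g 0..g pi} F" by (simp add: set_integrable_def PF g)
    have dg: "(g has_real_derivative (x - v) * sin t / 2) (at t)" for t
      unfolding g_def by (auto intro!: derivative_eq_intros)
    have cg: "continuous_on {0..pi} (\<lambda>t. (x - v) * sin t / 2)"
      by (intro continuous_intros) auto
    have pg: "0 \<le> (x - v) * sin t / 2" if "t \<in> {0..pi}" for t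
      using that True by (simp add: sin_ge_zero)
    have "(\<integral>u. P (v,u) \<partial>lborel) = (LBINT u. F u * indicator {g 0..g pi} u)"
      by (simp add: PF g mult.commute)
    also have "\<dots> = (LBINT t. F (g t) * ((x - v) * sin t / 2) * indicator {0..pi} t)"
      using si dg cg pg by (intro integral_substitution(2)) auto
    also have "\<dots> = (LBINT t. indicator {0..pi} t *\<^sub>R A v (g t))"
    proof (rule integral_cong_AE)
      show "(\<lambda>t. indicator {0..pi} t *\<^sub>R A v (g t)) \<in> borel_measurable lborel"
        using borel_measurable_continuous_on_indicator[OF _ cA] by simp
      have "set_integrable lborel {0..pi} (\<lambda>t. F (g t) * ((x - v) * sin t / 2))"
        using si dg cg pg by (intro integral_substitution(1)) auto
      from borel_measurable_integrable[OF this[unfolded set_integrable_def]]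
      show "(\<lambda>t. F (g t) * ((x - v) * sin t / 2) * indicator {0..pi} t) \<in> borel_measurable lborel"
        by (simp add: mult.commute)
      have "AE t in lborel. t \<noteq> 0 \<and> t \<noteq> pi" using AE_lborel_singleton[of "0::real"] AE_lborel_singleton[of pi] by auto
      then show "AE t in lborel. F (g t) * ((x - v) * sin t / 2) * indicator {0..pi} t = indicator {0..pi} t *\<^sub>R A v (g t)"
      proof eventually_elim
        case (elim t)
        show ?case
        proof (cases "t \<in> {0<..<pi}")
          case t: True
          have "sqrt (g t - v) * sqrt (x - g t) = (x - v) * sin t / 2" "sin t > 0"
            using arcsine_substitution[of v x t] t True unfolding g_def by auto
          then show ?thesis using t True by (simp add: F_def)
        qed (use elim in auto)
      qed
    qed
    also have "\<dots> = (LBINT t:{0..pi}. A v (g t))" by (simp add: set_lebesgue_integral_def)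
    also have "\<dots> = G v"
    proof -
      have "set_integrable lborel {0..pi} (\<lambda>t. A v (g t))"
        using cA by (intro borel_integrable_atLeastAtMost')
      from set_borel_integral_eq_integral(2)[OF this] show ?thesis by (simp add: G_def g_def)
    qed
    finally show ?thesis using True by simp
  next
    case False
    then have "P (v,u) = 0" for u using that by (auto simp: P_def T_def split: split_indicator)
    moreover have "v \<notin> {0..x}" using False that by auto
    ultimately show ?thesis by simp
  qed
  have "integral {0..x} G = (LBINT v:{0..x}. G v)"
    using set_borel_integral_eq_integral(2)[OF borel_integrable_atLeastAtMost'[OF contG]] by simp
  also have "\<dots> = (\<integral>v. (\<integral>u. P (v,u) \<partial>lborel) \<partial>lborel)"
    unfolding set_lebesgue_integral_def
  proof (rule integral_cong_AE)
    show "(\<lambda>v. indicator {0..x} v *\<^sub>R G v) \<in> borel_measurable lborel"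
      using borel_measurable_continuous_on_indicator[OF _ contG] by simp
    show "(\<lambda>v. \<integral>u. P (v,u) \<partial>lborel) \<in> borel_measurable lborel"
      by measurable
    show "AE v in lborel. indicator {0..x} v *\<^sub>R G v = (\<integral>u. P (v,u) \<partial>lborel)"
      using AE_lborel_singleton[of x] by eventually_elim (use right in auto)
  qed
  also have "\<dots> = (\<integral>u. (\<integral>v. P (v,u) \<partial>lborel) \<partial>lborel)"
    using lborel_pair.Fubini_integral[OF Pint'] by simp
  also have "\<dots> = (\<integral>u. 0 \<partial>(lborel :: real measure))"
  proof (rule integral_cong_AE)
    have "AE u in (lborel :: real measure). u \<noteq> 0 \<and> u \<noteq> x"
      using AE_lborel_singleton[of "0::real"] AE_lborel_singleton[of x] by auto
    then show "AE u in lborel. (\<integral>v. P (v,u) \<partial>lborel) = 0"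
      by eventually_elim (use left in auto)
  qed measurable
  finally show ?thesis by (simp add: G_def)
qed

lemma has_integral_versine: "((\<lambda>t::real. (1 - cos t) / 2) has_integral pi / 2) {0..pi}"
proof -
  have "((\<lambda>t. (1 - cos t) / 2) has_integral (pi - sin pi) / 2 - (0 - sin 0) / 2) {0..pi}"
    by (rule fundamental_theorem_of_calculus)
       (auto intro!: derivative_eq_intros simp flip: has_real_derivative_iff_has_vector_derivative)
  then show ?thesis by simp
qed

section \<open>Local uniqueness for Abel equations, also with a zero on the diagonal\<close>

text \<open>
  The equation delivered by \<open>abel_composition\<close> reads \<open>\<integral>\<^sub>0\<^sup>x H(v) G(x, v) dv = 0\<close>, where
  \<open>G(x, v)\<close> integrates \<open>k(v + (x - v) (1 - cos t) / 2, v)\<close> over \<open>0 \<le> t \<le> \<pi>\<close>; its derivative in \<open>x\<close> is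
  \<open>G(x, x) H(x) + \<integral>\<^sub>0\<^sup>x H \<partial>\<^sub>x G\<close>.  If \<open>k\<close> is \<open>\<epsilon>\<close>-close to having slope \<open>\<kappa>\<close> in \<open>u\<close>, then \<open>G\<close> is close
  to having slope \<open>\<kappa> \<pi> / 2\<close>, because the average of \<open>(1 - cos t) / 2\<close> is \<open>1 / 2\<close>.  Stating closeness
  by difference quotients avoids differentiating under the integral sign.
\<close>
lemma abel_derivative_bound:
  fixes H :: "real \<Rightarrow> real" and k :: "real \<Rightarrow> real \<Rightarrow> real"
  assumes a: "0 < a"
    and contH: "continuous_on {0..a} H"
    and contk: "continuous_on {(v, u). 0 \<le> v \<and> v \<le> u \<and> u \<le> a} (\<lambda>(v, u). k u v)"
    and eq: "\<And>u. 0 < u \<Longrightarrow> u < a \<Longrightarrow> (LBINT v:{0..u}. H v * k u v / sqrt (u - v)) = 0"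
    and lip: "\<And>v u u'. 0 \<le> v \<Longrightarrow> v \<le> u \<Longrightarrow> u \<le> u' \<Longrightarrow> u' \<le> a \<Longrightarrow>
        \<bar>k u' v - k u v - \<kappa> * (u' - u)\<bar> \<le> \<epsilon> * (u' - u)"
    and M: "\<And>v. v \<in> {0..a} \<Longrightarrow> \<bar>H v\<bar> \<le> M"
    and x: "x \<in> {0..a}"
  shows "\<bar>k x x * H x + \<kappa> / 2 * integral {0..x} H\<bar> \<le> \<epsilon> / 2 * x * M"
proof -
  have M0: "0 \<le> M" using M[of 0] a by auto
  have ep0: "0 \<le> \<epsilon>"
  proof -
    have "0 \<le> \<epsilon> * a" using lip[of 0 0 a] a by auto
    then show ?thesis using a by (simp add: zero_le_mult_iff)
  qed
  have contk': "continuous_on {(v, u). 0 \<le> v \<and> v \<le> u \<and> u \<le> x} (\<lambda>(v, u). k u v)" if "x \<in> {0..a}" for x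
    by (rule continuous_on_subset[OF contk]) (use that in auto)
  have pos: "\<bar>k x x * H x + \<kappa> / 2 * integral {0..x} H\<bar> \<le> \<epsilon> / 2 * x * M" if x: "x \<in> {0<..a}" for x
  proof -
    define G where "G = (\<lambda>x v. integral {0..pi} (\<lambda>t. k (v + (x - v) * (1 - cos t) / 2) v))"
    have Gcont2: "continuous_on ({0..y} \<times> cbox 0 pi) (\<lambda>(v,t). k (v + (y - v) * (1 - cos t) / 2) v)"
      if "y \<in> {0..a}" for y
      using continuous_on_versine_average[OF contk'[OF that]] by simp
    have Gcont: "continuous_on {0..y} (G y)" if "y \<in> {0..a}" for y
      using integral_continuous_on_param[OF Gcont2[OF that]] by (simp add: G_def)
    have kcont: "continuous_on {0..pi} (\<lambda>t. k (v + (y - v) * (1 - cos t) / 2) v)"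
      if "y \<in> {0..a}" "v \<in> {0..y}" for y v
    proof -
      have "continuous_on {0..pi} (\<lambda>t. (\<lambda>(v,t). k (v + (y - v) * (1 - cos t) / 2) v) (v, t))"
        by (intro continuous_on_compose2[OF Gcont2[OF that(1)]] continuous_intros) (use that in auto)
      then show ?thesis by simp
    qed
    have zero: "integral {0..y} (\<lambda>v. H v * G y v) = 0" if y: "y \<in> {0<..a}" for y
    proof -
      have "integral {0..y} (\<lambda>v. integral {0..pi} (\<lambda>t. H v * k (v + (y - v) * (1 - cos t) / 2) v)) = 0"
      proof (rule abel_composition)
        have "continuous_on {(v, u). 0 \<le> v \<and> v \<le> u \<and> u \<le> y} (\<lambda>z. H (fst z) * (\<lambda>(v, u). k u v) z)"
          using y by (intro continuous_intros continuous_on_compose2[OF contH] contk') auto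
        then show "continuous_on {(v, u). 0 \<le> v \<and> v \<le> u \<and> u \<le> y} (\<lambda>(v, u). H v * k u v)"
          by (simp add: case_prod_unfold)
      qed (use y eq in auto)
      then show ?thesis by (simp add: G_def)
    qed
    have Gdiff: "\<bar>G x v - G y v - \<kappa> * pi / 2 * (x - y)\<bar> \<le> \<epsilon> * pi / 2 * (x - y)"
      if "0 \<le> v" "v \<le> y" "y \<le> x" for v y
    proof -
      define d where "d = (\<lambda>t. k (v + (x - v) * (1 - cos t) / 2) v - k (v + (y - v) * (1 - cos t) / 2) v
          - \<kappa> * (x - y) * ((1 - cos t) / 2))"
      have c: "continuous_on {0..pi} (\<lambda>t. k (v + (x - v) * (1 - cos t) / 2) v)"
        "continuous_on {0..pi} (\<lambda>t. k (v + (y - v) * (1 - cos t) / 2) v)"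
        using that x by (auto intro!: kcont)
      have "(d has_integral (G x v - G y v - \<kappa> * (x - y) * (pi / 2))) {0..pi}"
        unfolding d_def G_def using c
        by (intro has_integral_diff has_integral_mult_right has_integral_versine
              integrable_integral integrable_continuous_interval)
      then have "G x v - G y v - \<kappa> * pi / 2 * (x - y) = integral {0..pi} d"
        by (simp add: integral_unique)
      also have "\<bar>integral {0..pi} d\<bar> \<le> integral {0..pi} (\<lambda>t. \<epsilon> * (x - y) * ((1 - cos t) / 2))"
        unfolding real_norm_def[symmetric]
      proof (rule integral_norm_bound_integral)
        show "d integrable_on {0..pi}" unfolding d_def
          by (intro integrable_continuous_interval continuous_intros c) auto
        show "(\<lambda>t. \<epsilon> * (x - y) * ((1 - cos t) / 2)) integrable_on {0..pi}"
          by (intro integrable_continuous_interval continuous_intros) auto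
        show "norm (d t) \<le> \<epsilon> * (x - y) * ((1 - cos t) / 2)" for t
        proof -
          have e: "v + (x - v) * (1 - cos t) / 2 - (v + (y - v) * (1 - cos t) / 2) = (x - y) * ((1 - cos t) / 2)"
            by (simp add: field_simps)
          have "(x - y) * ((1 - cos t) / 2) \<ge> 0" using that by simp
          then have "v + (y - v) * (1 - cos t) / 2 \<le> v + (x - v) * (1 - cos t) / 2" using e by linarith
          then show ?thesis
            using lip[of v "v + (y - v) * (1 - cos t) / 2" "v + (x - v) * (1 - cos t) / 2"]
              versine_between[of v y t] versine_between[of v x t] that x
            unfolding d_def e by (simp add: mult.assoc)
        qed
      qed
      also have "integral {0..pi} (\<lambda>t. \<epsilon> * (x - y) * ((1 - cos t) / 2)) = \<epsilon> * (x - y) * (pi / 2)"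
        by (intro integral_unique has_integral_mult_right has_integral_versine)
      finally show ?thesis by (simp add: mult.assoc mult.commute mult.left_commute)
    qed
    have Gxx: "G x x = pi * k x x" by (simp add: G_def)
    have cHG: "continuous_on {0..y} (\<lambda>v. H v * G y v)" if "y \<in> {0..a}" for y
      by (intro continuous_intros Gcont that continuous_on_subset[OF contH]) (use that in auto)
    define B where "B = (\<lambda>z. integral {0..z} (\<lambda>v. H v * G x v))"
    \<comment> \<open>Subtracting the equations at \<open>x\<close> and \<open>y\<close> bounds this expression, and its limit as \<open>y\<close> tends to \<open>x\<close> from the left is \<open>\<pi>\<close> times the quantity to be estimated.\<close>
    define q where "q = (\<lambda>y. (B y - B x) / (y - x) + \<kappa> * pi / 2 * integral {0..y} H)"
    have qb: "\<bar>q y\<bar> \<le> \<epsilon> * pi / 2 * y * M" if y: "0 < y" "y < x" for y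
    proof -
      have cx: "continuous_on {0..y} (\<lambda>v. H v * G x v)"
        by (rule continuous_on_subset[OF cHG]) (use x y in auto)
      have cy: "continuous_on {0..y} (\<lambda>v. H v * G y v)"
        using cHG[of y] x y by auto
      have cH: "continuous_on {0..y} H"
        by (rule continuous_on_subset[OF contH]) (use x y in auto)
      have "B x = 0" using zero[of x] x by (simp add: B_def)
      moreover have "integral {0..y} (\<lambda>v. H v * G y v) = 0" using zero[of y] x y by simp
      ultimately have "q y = (integral {0..y} (\<lambda>v. H v * G x v) - integral {0..y} (\<lambda>v. H v * G y v)
            - \<kappa> * pi / 2 * (x - y) * integral {0..y} H) / (y - x)"
        using y by (simp add: q_def B_def field_simps)
      also have "\<dots> = integral {0..y} (\<lambda>v. H v * (G x v - G y v - \<kappa> * pi / 2 * (x - y))) / (y - x)"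
      proof -
        have "integral {0..y} (\<lambda>v. H v * (G x v - G y v - \<kappa> * pi / 2 * (x - y)))
          = integral {0..y} (\<lambda>v. H v * G x v - H v * G y v - \<kappa> * pi / 2 * (x - y) * H v)"
          by (simp add: algebra_simps)
        also have "\<dots> = integral {0..y} (\<lambda>v. H v * G x v) - integral {0..y} (\<lambda>v. H v * G y v)
            - \<kappa> * pi / 2 * (x - y) * integral {0..y} H"
          using cx cy cH
          by (simp add: integral_diff integrable_continuous_interval continuous_on_diff continuous_on_mult_left)
        finally show ?thesis by simp
      qed
      finally have qe: "q y = integral {0..y} (\<lambda>v. H v * (G x v - G y v - \<kappa> * pi / 2 * (x - y))) / (y - x)" .
      have cGy: "continuous_on {0..y} (G y)" using Gcont[of y] x y by auto
      have cGx: "continuous_on {0..y} (G x)" by (rule continuous_on_subset[OF Gcont[of x]]) (use x y in auto)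
      have "\<bar>integral {0..y} (\<lambda>v. H v * (G x v - G y v - \<kappa> * pi / 2 * (x - y)))\<bar>
          \<le> integral {0..y} (\<lambda>v. M * (\<epsilon> * pi / 2 * (x - y)))"
        unfolding real_norm_def[symmetric]
      proof (rule integral_norm_bound_integral)
        show "(\<lambda>v. H v * (G x v - G y v - \<kappa> * pi / 2 * (x - y))) integrable_on {0..y}"
          by (intro integrable_continuous_interval continuous_intros cH cGx cGy)
        show "norm (H v * (G x v - G y v - \<kappa> * pi / 2 * (x - y))) \<le> M * (\<epsilon> * pi / 2 * (x - y))"
          if "v \<in> {0..y}" for v
          unfolding real_norm_def abs_mult using that x y M0
          by (intro mult_mono M Gdiff) auto
      qed (intro integrable_continuous_interval continuous_intros)
      also have "\<dots> = \<epsilon> * pi / 2 * y * M * (x - y)" using y by simp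
      finally show ?thesis
        using y unfolding qe by (simp add: abs_divide divide_le_eq abs_minus_commute)
    qed
    have "(B has_real_derivative H x * G x x) (at x within {0..x})"
      unfolding B_def using integral_has_real_derivative[OF cHG, of x x] x by auto
    then have "((\<lambda>y. (B y - B x) / (y - x)) \<longlongrightarrow> H x * G x x) (at x within {0..x})"
      by (simp add: has_field_derivative_iff)
    moreover have "((\<lambda>y. integral {0..y} H) \<longlongrightarrow> integral {0..x} H) (at x within {0..x})"
    proof -
      have "continuous_on {0..x} (\<lambda>y. integral {0..y} H)"
        by (intro indefinite_integral_continuous_1 integrable_continuous_interval continuous_on_subset[OF contH])
           (use x in auto)
      then show ?thesis using x by (auto simp: continuous_on_def)
    qed
    ultimately have "(q \<longlongrightarrow> H x * G x x + \<kappa> * pi / 2 * integral {0..x} H) (at x within {0..x})"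
      unfolding q_def by (intro tendsto_intros)
    then have lim1: "((\<lambda>y. \<bar>q y\<bar>) \<longlongrightarrow> \<bar>H x * G x x + \<kappa> * pi / 2 * integral {0..x} H\<bar>) (at x within {0..x})"
      by (intro tendsto_intros)
    have lim2: "((\<lambda>y. \<epsilon> * pi / 2 * y * M) \<longlongrightarrow> \<epsilon> * pi / 2 * x * M) (at x within {0..x})"
      by (intro tendsto_intros)
    have "at x within {0..x} \<noteq> bot"
      using x by (subst trivial_limit_within) (simp add: islimpt_Icc)
    then have "\<bar>H x * G x x + \<kappa> * pi / 2 * integral {0..x} H\<bar> \<le> \<epsilon> * pi / 2 * x * M"
    proof (rule tendsto_le[OF _ lim2 lim1])
      have "eventually (\<lambda>y. y \<in> {0<..}) (at x within {0..x})"
        by (rule topological_tendstoD[OF tendsto_ident_at]) (use x in auto)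
      moreover have "eventually (\<lambda>y. y \<in> {0..x} \<and> y \<noteq> x) (at x within {0..x})"
        by (auto simp: eventually_at_filter)
      ultimately show "eventually (\<lambda>y. \<bar>q y\<bar> \<le> \<epsilon> * pi / 2 * y * M) (at x within {0..x})"
        by eventually_elim (use qb in auto)
    qed
    then have "pi * \<bar>k x x * H x + \<kappa> / 2 * integral {0..x} H\<bar> \<le> pi * (\<epsilon> / 2 * x * M)"
    proof -
      have "H x * G x x + \<kappa> * pi / 2 * integral {0..x} H = pi * (k x x * H x + \<kappa> / 2 * integral {0..x} H)"
        by (simp add: Gxx algebra_simps)
      moreover have "\<epsilon> * pi / 2 * x * M = pi * (\<epsilon> / 2 * x * M)" by simp
      moreover assume "\<bar>H x * G x x + \<kappa> * pi / 2 * integral {0..x} H\<bar> \<le> \<epsilon> * pi / 2 * x * M"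
      ultimately show ?thesis by (simp only: abs_mult) simp
    qed
    then show ?thesis by (simp only: mult_le_cancel_left_pos pi_gt_zero)
  qed
  have kdiag: "continuous_on {0..a} (\<lambda>x. k x x)"
  proof -
    have "continuous_on {0..a} (\<lambda>x. (\<lambda>(v, u). k u v) (x, x))"
      by (intro continuous_on_compose2[OF contk] continuous_intros) auto
    then show ?thesis by simp
  qed
  have "0 \<le> \<epsilon> / 2 * x * M - \<bar>k x x * H x + \<kappa> / 2 * integral {0..x} H\<bar>"
  proof (rule continuous_ge_on_closure[where S = "{0<..a}"
        and f = "\<lambda>x. \<epsilon> / 2 * x * M - \<bar>k x x * H x + \<kappa> / 2 * integral {0..x} H\<bar>"])
    show "continuous_on (closure {0<..a}) (\<lambda>x. \<epsilon> / 2 * x * M - \<bar>k x x * H x + \<kappa> / 2 * integral {0..x} H\<bar>)"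
      unfolding closure_greaterThanAtMost[OF a]
      by (intro continuous_intros indefinite_integral_continuous_1 integrable_continuous_interval contH kdiag) auto
  qed (use x a pos in \<open>auto simp: closure_greaterThanAtMost\<close>)
  then show ?thesis by simp
qed

text \<open>
  With \<open>\<kappa> = 0\<close> the bound says that \<open>\<bar>H\<bar>\<close> is at most a small multiple of its own maximum on a
  short interval.
\<close>
lemma regular_abel_equation_local_uniqueness:
  fixes H :: "real \<Rightarrow> real" and k :: "real \<Rightarrow> real \<Rightarrow> real"
  assumes a: "0 < a"
    and contH: "continuous_on {0..a} H"
    and contk: "continuous_on {(v, u). 0 \<le> v \<and> v \<le> u \<and> u \<le> a} (\<lambda>(v, u). k u v)"
    and eq: "\<And>u. 0 < u \<Longrightarrow> u < a \<Longrightarrow> (LBINT v:{0..u}. H v * k u v / sqrt (u - v)) = 0"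
    and lip: "\<And>v u u'. 0 \<le> v \<Longrightarrow> v \<le> u \<Longrightarrow> u \<le> u' \<Longrightarrow> u' \<le> a \<Longrightarrow>
        \<bar>k u' v - k u v\<bar> \<le> L * (u' - u)"
    and k0: "k 0 0 \<noteq> 0"
  shows "\<exists>\<delta>>0. \<delta> \<le> a \<and> (\<forall>v\<in>{0..\<delta>}. H v = 0)"
proof -
  have L0: "0 \<le> L"
  proof -
    have "0 \<le> L * a" using lip[of 0 0 a] a by auto
    then show ?thesis using a by (simp add: zero_le_mult_iff)
  qed
  have "continuous_on {0..a} (\<lambda>x. (\<lambda>(v, u). k u v) (x, x))"
    by (intro continuous_on_compose2[OF contk] continuous_intros) auto
  then have kd: "continuous_on {0..a} (\<lambda>x. k x x)" by simp
  define m where "m = \<bar>k 0 0\<bar> / 2"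
  have m: "0 < m" using k0 by (simp add: m_def)
  have "\<exists>d>0. \<forall>x\<in>{0..a}. dist x 0 < d \<longrightarrow> dist (k x x) (k 0 0) < m"
    using kd[unfolded continuous_on_iff, rule_format, of 0 m] a m by auto
  then obtain d where d: "d > 0" "\<And>x. x \<in> {0..a} \<Longrightarrow> x < d \<Longrightarrow> \<bar>k x x - k 0 0\<bar> < m"
    by (auto simp: dist_real_def)
  define \<delta> where "\<delta> = min (min a (d / 2)) (m / (L + 1))"
  have "0 < m / (L + 1)" using m L0 by simp
  moreover have "\<delta> \<le> a" "\<delta> \<le> d / 2" unfolding \<delta>_def by linarith+
  ultimately have \<delta>: "0 < \<delta>" "\<delta> \<le> a" "\<delta> < d" using a d(1) by (auto simp: \<delta>_def)
  have Lm: "L * \<delta> < m"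
  proof -
    have "L * \<delta> \<le> L * (m / (L + 1))" using L0 by (intro mult_left_mono) (auto simp: \<delta>_def)
    also have "\<dots> < m" using L0 m by (simp add: field_simps)
    finally show ?thesis .
  qed
  have contH': "continuous_on {0..\<delta>} H" by (rule continuous_on_subset[OF contH]) (use \<delta> in auto)
  obtain z where z: "z \<in> {0..\<delta>}" "\<And>v. v \<in> {0..\<delta>} \<Longrightarrow> \<bar>H v\<bar> \<le> \<bar>H z\<bar>"
    using continuous_attains_sup[of "{0..\<delta>}" "\<lambda>v. \<bar>H v\<bar>"] \<delta> contH' by (fastforce intro: continuous_intros)
  have "\<bar>k z z * H z + 0 / 2 * integral {0..z} H\<bar> \<le> L / 2 * z * \<bar>H z\<bar>"
  proof (rule abel_derivative_bound[where a = \<delta> and H = H and k = k])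
    show "continuous_on {(v, u). 0 \<le> v \<and> v \<le> u \<and> u \<le> \<delta>} (\<lambda>(v, u). k u v)"
      by (rule continuous_on_subset[OF contk]) (use \<delta> in auto)
  qed (use z \<delta> contH' eq lip in auto)
  moreover have "m \<le> \<bar>k z z\<bar>"
  proof -
    have "\<bar>k z z - k 0 0\<bar> < \<bar>k 0 0\<bar> / 2" using d(2)[of z] z \<delta> by (auto simp: m_def)
    then show ?thesis unfolding m_def by linarith
  qed
  then have "m * \<bar>H z\<bar> \<le> \<bar>k z z\<bar> * \<bar>H z\<bar>" by (rule mult_right_mono) simp
  ultimately have "m * \<bar>H z\<bar> \<le> L / 2 * z * \<bar>H z\<bar>" by (simp add: abs_mult)
  also have "L / 2 * z * \<bar>H z\<bar> \<le> L * \<delta> * \<bar>H z\<bar>"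
  proof (rule mult_right_mono)
    have "L * z \<le> L * \<delta>" "0 \<le> L * z" using z L0 by (auto intro: mult_left_mono)
    then show "L / 2 * z \<le> L * \<delta>" by simp
  qed simp
  finally have "H z = 0" using Lm by (simp add: mult_le_cancel_right)
  then have "\<forall>v\<in>{0..\<delta>}. H v = 0" using z by auto
  then show ?thesis using \<delta> by blast
qed

text \<open>
  Perturbed Euler equation: \<open>(x powr p I(x))' = x powr (p - 1) (x h(x) + p I(x))\<close>, so the
  hypothesis bounds the derivative of \<open>x powr p I(x)\<close> by \<open>e x powr p\<close>.  The condition \<open>p > - 1\<close> makes
  this integrable at \<open>0\<close> and, with \<open>I(x) = O(x)\<close>, forces \<open>x powr p I(x)\<close> to start from \<open>0\<close>.
\<close>
lemma euler_inequality:
  fixes I h :: "real \<Rightarrow> real"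
  assumes p: "-1 < p"
    and der: "\<And>x. 0 < x \<Longrightarrow> x < d \<Longrightarrow> (I has_real_derivative h x) (at x)"
    and ineq: "\<And>x. 0 < x \<Longrightarrow> x < d \<Longrightarrow> \<bar>x * h x + p * I x\<bar> \<le> e * x"
    and bound: "\<And>x. 0 < x \<Longrightarrow> x < d \<Longrightarrow> \<bar>I x\<bar> \<le> M * x"
    and x: "0 < x" "x < d"
  shows "\<bar>I x\<bar> \<le> e / (p + 1) * x"
proof -
  have signed: "s * I x \<le> e / (p + 1) * x" if s: "\<bar>s\<bar> = 1" for s :: real
  proof -
    \<comment> \<open>\<open>J\<close> is nondecreasing by the differential inequality and tends to \<open>0\<close> at \<open>0\<close>, hence \<open>J x \<ge> 0\<close>.\<close>
    define J where "J = (\<lambda>y. e / (p + 1) * y powr (p + 1) - s * (y powr p * I y))"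
    have dJ: "(J has_real_derivative y powr (p - 1) * (e * y - s * (y * h y + p * I y))) (at y)"
      if "0 < y" "y < d" for y
    proof -
      have "(J has_real_derivative e / (p + 1) * ((p + 1) * y powr p)
          - s * (p * y powr (p - 1) * I y + h y * y powr p)) (at y)"
        unfolding J_def using that p
        by (auto intro!: derivative_eq_intros der simp: add.commute)
      moreover have "y powr p = y powr (p - 1) * y"
        using that powr_add[of y "p - 1" 1] by simp
      moreover have "e / (p + 1) * ((p + 1) * y powr p) = e * y powr p" using p by simp
      ultimately show ?thesis by (simp add: algebra_simps)
    qed
    have mono: "J y \<le> J x" if "0 < y" "y \<le> x" for y
    proof (rule DERIV_nonneg_imp_nondecreasing[OF that(2)])
      fix t assume t: "y \<le> t" "t \<le> x"
      have "s * (t * h t + p * I t) \<le> e * t"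
        using ineq[of t] t that x s abs_ge_self[of "s * (t * h t + p * I t)"] by (simp add: abs_mult)
      then show "\<exists>D. (J has_real_derivative D) (at t) \<and> 0 \<le> D"
        using dJ[of t] t that x by (intro exI conjI) auto
    qed
    have lim: "((\<lambda>y::real. y powr (p + 1)) \<longlongrightarrow> 0) (at_right 0)"
      using p by (intro tendsto_eq_intros) (auto simp: eventually_at_filter tendsto_ident_at)
    have "(J \<longlongrightarrow> e / (p + 1) * 0 - s * 0) (at_right 0)"
      unfolding J_def
    proof (intro tendsto_intros lim)
      show "((\<lambda>y. y powr p * I y) \<longlongrightarrow> 0) (at_right 0)"
      proof (rule Lim_null_comparison)
        show "((\<lambda>y. M * y powr (p + 1)) \<longlongrightarrow> 0) (at_right 0)"
          using tendsto_mult_right[OF lim, of M] tendsto_mult_left[OF lim, of M] by simp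
        have "eventually (\<lambda>y. y \<in> {0<..<d}) (at_right 0)"
          using x by (intro eventually_at_right_real) auto
        then show "eventually (\<lambda>y. norm (y powr p * I y) \<le> M * y powr (p + 1)) (at_right 0)"
        proof eventually_elim
          case (elim y)
          then have "y powr p * \<bar>I y\<bar> \<le> y powr p * (M * y)" using bound by (intro mult_left_mono) auto
          then show ?case using elim by (simp add: abs_mult powr_add algebra_simps)
        qed
      qed
    qed
    then have J0: "(J \<longlongrightarrow> 0) (at_right 0)" by simp
    have "0 \<le> J x"
    proof (rule tendsto_upperbound[OF J0])
      have "eventually (\<lambda>y. y \<in> {0<..<x}) (at_right 0)"
        using x by (intro eventually_at_right_real) auto
      then show "eventually (\<lambda>y. J y \<le> J x) (at_right 0)"
        by eventually_elim (use mono in auto)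
    qed simp
    then have "x powr p * (s * I x) \<le> x powr p * (e / (p + 1) * x)"
      using x by (simp add: J_def powr_add algebra_simps)
    then show ?thesis using x by (simp only: mult_le_cancel_left_pos powr_gt_zero)
  qed
  show ?thesis using signed[of 1] signed[of "-1"] by auto
qed

text \<open>
  If the diagonal has a simple zero at the origin, the leading part of the differentiated equation
  is \<open>c (x H(x) + p \<integral>\<^sub>0\<^sup>x H)\<close> with \<open>p = \<kappa> / (2 c)\<close>.  The bound on the integral from
  \<open>euler_inequality\<close> shows that \<open>\<bar>H\<bar>\<close> is at most half its own maximum.
\<close>
lemma degenerate_abel_equation_local_uniqueness:
  fixes H :: "real \<Rightarrow> real" and k :: "real \<Rightarrow> real \<Rightarrow> real"
  assumes a: "0 < a"
    and contH: "continuous_on {0..a} H"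
    and contk: "continuous_on {(v, u). 0 \<le> v \<and> v \<le> u \<and> u \<le> a} (\<lambda>(v, u). k u v)"
    and eq: "\<And>u. 0 < u \<Longrightarrow> u < a \<Longrightarrow> (LBINT v:{0..u}. H v * k u v / sqrt (u - v)) = 0"
    and lip: "\<And>\<epsilon>. 0 < \<epsilon> \<Longrightarrow> \<exists>\<delta>>0. \<forall>v u u'. 0 \<le> v \<longrightarrow> v \<le> u \<longrightarrow> u \<le> u' \<longrightarrow> u' \<le> \<delta> \<longrightarrow>
        \<bar>k u' v - k u v - \<kappa> * (u' - u)\<bar> \<le> \<epsilon> * (u' - u)"
    and k0: "k 0 0 = 0"
    and diag: "((\<lambda>x. k x x) has_real_derivative c) (at 0 within {0..a})"
    and c: "c \<noteq> 0" and \<kappa>: "-1 < \<kappa> / (2 * c)"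
  shows "\<exists>\<delta>>0. \<delta> \<le> a \<and> (\<forall>v\<in>{0..\<delta>}. H v = 0)"
proof -
  define p where "p = \<kappa> / (2 * c)"
  have p: "-1 < p" using \<kappa> by (simp add: p_def)
  \<comment> \<open>Chosen so that the final estimate comes out as \<open>\<bar>H x\<bar> \<le> M / 2\<close>.\<close>
  define \<eta> where "\<eta> = 1 / (2 * (1 + \<bar>p\<bar> / (p + 1)))"
  have den: "1 + \<bar>p\<bar> / (p + 1) > 0" using p by (intro add_pos_nonneg) auto
  have \<eta>: "\<eta> > 0" "\<eta> * (1 + \<bar>p\<bar> / (p + 1)) = 1 / 2"
    using den by (simp_all add: \<eta>_def del: abs_divide)
  \<comment> \<open>The errors \<open>\<epsilon> / 2\<close> from the kernel and \<open>\<epsilon>\<close> from the diagonal add up to \<open>3 \<epsilon> / 2 = \<bar>c\<bar> \<eta>\<close>.\<close>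
  define \<epsilon> where "\<epsilon> = 2 * \<bar>c\<bar> * \<eta> / 3"
  have \<epsilon>: "\<epsilon> > 0" using \<eta> c by (simp add: \<epsilon>_def)
  obtain d1 where d1: "d1 > 0" "\<And>v u u'. 0 \<le> v \<Longrightarrow> v \<le> u \<Longrightarrow> u \<le> u' \<Longrightarrow> u' \<le> d1 \<Longrightarrow>
        \<bar>k u' v - k u v - \<kappa> * (u' - u)\<bar> \<le> \<epsilon> * (u' - u)"
    using lip[OF \<epsilon>] by blast
  have "((\<lambda>x. (k x x - k 0 0) / (x - 0)) \<longlongrightarrow> c) (at 0 within {0..a})"
    using diag unfolding has_field_derivative_iff .
  then have "eventually (\<lambda>x. dist (k x x / x) c < \<epsilon>) (at 0 within {0..a})"
    using \<epsilon> k0 by (auto dest: tendstoD)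
  then obtain d2 where d2: "d2 > 0" "\<And>x. x \<in> {0..a} \<Longrightarrow> x \<noteq> 0 \<Longrightarrow> x < d2 \<Longrightarrow> \<bar>k x x / x - c\<bar> < \<epsilon>"
    by (auto simp: eventually_at dist_real_def)
  define \<delta> where "\<delta> = min (min a d1) (d2 / 2)"
  have \<delta>: "0 < \<delta>" "\<delta> \<le> a" "\<delta> \<le> d1" "\<delta> < d2" using a d1 d2 by (auto simp: \<delta>_def)
  have contH': "continuous_on {0..\<delta>} H" by (rule continuous_on_subset[OF contH]) (use \<delta> in auto)
  obtain z where z: "z \<in> {0..\<delta>}" "\<And>v. v \<in> {0..\<delta>} \<Longrightarrow> \<bar>H v\<bar> \<le> \<bar>H z\<bar>"
    using continuous_attains_sup[of "{0..\<delta>}" "\<lambda>v. \<bar>H v\<bar>"] \<delta> contH' by (fastforce intro: continuous_intros)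
  define M where "M = \<bar>H z\<bar>"
  define I where "I = (\<lambda>x. integral {0..x} H)"
  have bnd: "\<bar>x * H x + p * I x\<bar> \<le> \<eta> * M * x" if x: "0 < x" "x < \<delta>" for x
  proof -
    have "\<bar>k x x * H x + \<kappa> / 2 * integral {0..x} H\<bar> \<le> \<epsilon> / 2 * x * M"
    proof (rule abel_derivative_bound[where a = \<delta> and H = H and k = k])
      show "continuous_on {(v, u). 0 \<le> v \<and> v \<le> u \<and> u \<le> \<delta>} (\<lambda>(v, u). k u v)"
        by (rule continuous_on_subset[OF contk]) (use \<delta> in auto)
    qed (use z x \<delta> contH' eq d1 in \<open>auto simp: M_def\<close>)
    moreover have "\<bar>(k x x - c * x) * H x\<bar> \<le> \<epsilon> * x * M"
    proof -
      have "\<bar>k x x - c * x\<bar> = \<bar>k x x / x - c\<bar> * x"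
        using x by (simp add: abs_mult_pos left_diff_distrib)
      also have "\<dots> \<le> \<epsilon> * x" using d2(2)[of x] x \<delta> by (intro mult_right_mono) auto
      finally show ?thesis using z(2)[of x] x \<epsilon> by (simp add: abs_mult M_def mult_mono)
    qed
    moreover have "c * (x * H x + p * I x) = (k x x * H x + \<kappa> / 2 * integral {0..x} H) - (k x x - c * x) * H x"
      using c by (simp add: p_def I_def field_simps)
    ultimately have "\<bar>c * (x * H x + p * I x)\<bar> \<le> \<epsilon> / 2 * x * M + \<epsilon> * x * M" by linarith
    also have "\<dots> = \<bar>c\<bar> * (\<eta> * M * x)" by (simp add: \<epsilon>_def field_simps)
    finally show ?thesis using c by (simp add: abs_mult)
  qed
  have derI: "(I has_real_derivative H x) (at x)" if x: "0 < x" "x < \<delta>" for x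
  proof -
    have "(I has_real_derivative H x) (at x within {0..\<delta>})"
      unfolding I_def using integral_has_real_derivative[OF contH', of x] x by auto
    then show ?thesis using x by (simp add: at_within_Icc_at)
  qed
  have boundI: "\<bar>I x\<bar> \<le> M * x" if x: "0 < x" "x < \<delta>" for x
  proof -
    have "norm (integral {0..x} H) \<le> integral {0..x} (\<lambda>_. M)"
      by (rule integral_norm_bound_integral)
         (use x z in \<open>auto simp: M_def intro!: integrable_continuous_interval continuous_on_subset[OF contH']\<close>)
    then show ?thesis using x by (simp add: I_def mult.commute)
  qed
  have half: "\<bar>H x\<bar> \<le> M / 2" if x: "x \<in> {0<..<\<delta>}" for x
  proof -
    have "\<bar>I x\<bar> \<le> \<eta> * M / (p + 1) * x"
      by (rule euler_inequality[OF p derI bnd boundI]) (use x in auto)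
    then have "\<bar>p * I x\<bar> \<le> \<bar>p\<bar> * (\<eta> * M / (p + 1) * x)"
      by (simp only: abs_mult mult_left_mono abs_ge_zero)
    then have "\<bar>x * H x\<bar> \<le> \<eta> * M * x + \<bar>p\<bar> * (\<eta> * M / (p + 1) * x)"
      using bnd[of x] x by auto
    also have "\<dots> = x * (\<eta> * (1 + \<bar>p\<bar> / (p + 1)) * M)" by (simp add: field_simps)
    finally show ?thesis using x unfolding \<eta>(2) by (simp add: abs_mult)
  qed
  have "0 \<le> M / 2 - \<bar>H z\<bar>"
  proof (rule continuous_ge_on_closure[where S = "{0<..<\<delta>}" and f = "\<lambda>x. M / 2 - \<bar>H x\<bar>"])
    show "continuous_on (closure {0<..<\<delta>}) (\<lambda>x. M / 2 - \<bar>H x\<bar>)"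
      using \<delta> contH' by (auto intro!: continuous_intros)
  qed (use z \<delta> half in auto)
  then have "H z = 0" by (simp add: M_def)
  then have "\<forall>v\<in>{0..\<delta>}. H v = 0" using z by auto
  then show ?thesis using \<delta> by blast
qed

section \<open>The kernel near the diagonal\<close>

lemma cos_int_pi_minus:
  "cos (of_int n * pi - y) = (- 1) powi n * cos (y::real)"
proof -
  have "sin (of_int n * pi) = (0::real)" by (simp add: sin_zero_iff_int2)
  moreover have "cos (of_int n * pi) = ((- 1) powi n :: real)"
  proof (cases "even n")
    case True
    then obtain m where "n = 2 * m" by blast
    then show ?thesis using cos_int_2pin[of m] by (simp add: mult.commute mult.left_commute)
  next
    case False
    then obtain m where "n = 2 * m + 1" by (blast elim: oddE)
    then have "of_int n * pi = 2 * pi * of_int m + pi" by (simp add: algebra_simps)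
    then show ?thesis using False cos_int_2pin[of m] by (simp only: cos_periodic_pi power_int_minus_left_odd) simp
  qed
  ultimately show ?thesis by (simp add: cos_diff)
qed

text \<open>
  The first form is \<open>F(t) + F(- t)\<close> for \<open>F(t) = exp (\<mu> t) cos (n (\<beta> - arctan (t / s)))\<close>, which is how the
  kernel arises from a chord.  In the second form, with \<open>\<theta> = arctan (t / s)\<close>,
  every term is even in \<open>t = sqrt (r\<^sup>2 - s\<^sup>2)\<close>, so the
  kernel is smooth in \<open>r\<^sup>2 - s\<^sup>2\<close> in spite of the square root.
\<close>
lemma kernel_K_eq:
  assumes "0 < s" "s \<le> r" "r \<le> R"
  defines "t \<equiv> sqrt (r\<^sup>2 - s\<^sup>2)" and "\<beta> \<equiv> arccos (s / R)" and "\<theta> \<equiv> arccos (s / r)"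
  shows "kernel_K R \<mu> n s r = exp (\<mu> * t) * cos (of_int n * (\<beta> - \<theta>)) + exp (- \<mu> * t) * cos (of_int n * (\<beta> + \<theta>))"
    and "kernel_K R \<mu> n s r = 2 * (cosh (\<mu> * t) * cos (of_int n * \<beta>) * cos (of_int n * \<theta>)
           + sinh (\<mu> * t) * sin (of_int n * \<beta>) * sin (of_int n * \<theta>))"
proof -
  have a: "arcsin (s / r) = pi / 2 - \<theta>" "arcsin (s / R) = pi / 2 - \<beta>"
    using assms arcsin_arccos_eq[of "s / r"] arcsin_arccos_eq[of "s / R"] by (auto simp: field_simps)
  have e: "of_int n * (pi / 2 - \<theta> + (pi / 2 - \<beta>)) = of_int n * pi - of_int n * (\<beta> + \<theta>)"
    by (simp add: algebra_simps)
  have sq: "(- 1) powi n * ((- 1) powi n) = (1::real)"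
    by (simp flip: power_int_mult_distrib)
  have e': "(- 1) powi n * cos (of_int n * (pi / 2 - \<theta> + (pi / 2 - \<beta>))) = cos (of_int n * (\<beta> + \<theta>))"
    unfolding e cos_int_pi_minus using sq by (simp flip: mult.assoc)
  have "kernel_K R \<mu> n s r = exp (\<mu> * t) * cos (of_int n * (\<beta> - \<theta>))
      + exp (- \<mu> * t) * ((- 1) powi n * cos (of_int n * (pi / 2 - \<theta> + (pi / 2 - \<beta>))))"
    unfolding kernel_K_def by (simp add: a t_def[symmetric])
  then show 1: "kernel_K R \<mu> n s r = exp (\<mu> * t) * cos (of_int n * (\<beta> - \<theta>)) + exp (- \<mu> * t) * cos (of_int n * (\<beta> + \<theta>))"
    unfolding e' .
  show "kernel_K R \<mu> n s r = 2 * (cosh (\<mu> * t) * cos (of_int n * \<beta>) * cos (of_int n * \<theta>)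
           + sinh (\<mu> * t) * sin (of_int n * \<beta>) * sin (of_int n * \<theta>))"
    unfolding 1 by (simp add: cosh_def sinh_def distrib_left right_diff_distrib cos_add cos_diff field_simps)
qed

lemma kernel_K_diagonal:
  assumes "0 < s" "s \<le> R"
  shows "kernel_K R \<mu> n s s = 2 * cos (of_int n * arccos (s / R))"
  using kernel_K_eq(2)[of s s R \<mu> n] assms by simp

lemma continuous_on_kernel_K:
  "continuous_on {(s, r). 0 < s \<and> s \<le> r \<and> r \<le> R} (\<lambda>(s, r). kernel_K R \<mu> n s r)"
proof -
  have "continuous_on {(s, r). 0 < s \<and> s \<le> r \<and> r \<le> R} (\<lambda>z. kernel_K R \<mu> n (fst z) (snd z))"
    unfolding kernel_K_def
    by (intro continuous_intros) (auto simp: field_simps power_int_not_zero)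
  then show ?thesis by (simp add: case_prod_unfold)
qed

lemma tendsto_sin_mult_over: "((\<lambda>y. sin (a * y) / y) \<longlongrightarrow> a) (at (0::real))"
proof -
  have "((\<lambda>y. sin (a * y)) has_real_derivative a) (at 0)" by (auto intro!: derivative_eq_intros)
  then show ?thesis by (simp add: has_field_derivative_iff)
qed

lemma tendsto_sinh_mult_over: "((\<lambda>y. sinh (a * y) / y) \<longlongrightarrow> a) (at (0::real))"
proof -
  have "((\<lambda>y. sinh (a * y)) has_real_derivative a) (at 0)" by (auto intro!: derivative_eq_intros)
  then show ?thesis by (simp add: has_field_derivative_iff)
qed

lemma tendsto_sin_mult_over_sin: "((\<lambda>y. sin (a * y) / sin y) \<longlongrightarrow> a) (at (0::real))"
proof -
  have "((\<lambda>y. (sin (a * y) / y) / (sin (1 * y) / y)) \<longlongrightarrow> a / 1) (at (0::real))"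
    by (intro tendsto_divide tendsto_sin_mult_over) auto
  moreover have "eventually (\<lambda>y. (sin (a * y) / y) / (sin (1 * y) / y) = sin (a * y) / sin y) (at (0::real))"
    by (auto simp: eventually_at_filter)
  ultimately have "((\<lambda>y. sin (a * y) / sin y) \<longlongrightarrow> a / 1) (at (0::real))"
    by (rule Lim_transform_eventually)
  then show ?thesis by simp
qed

context
  fixes R \<mu> s0 :: real and n :: int
  assumes s0: "0 < s0" "s0 \<le> R"
begin

text \<open>
  Notation for the variables \<open>u = s\<^sub>0\<^sup>2 - s\<^sup>2\<close> and \<open>v = s\<^sub>0\<^sup>2 - r\<^sup>2\<close>: then \<open>S u = s\<close> and \<open>S v = r\<close>, while \<open>t u v\<close> and
  \<open>b u\<close> are the half-chords \<open>sqrt (r\<^sup>2 - s\<^sup>2)\<close> and \<open>sqrt (R\<^sup>2 - s\<^sup>2)\<close>.  The angles satisfy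
  \<open>sin \<beta> = b / R\<close> and \<open>sin \<theta> = t / r\<close>.  \<open>D\<close> is the derivative of the kernel with
  respect to \<open>u\<close>, grouped into quotients that stay bounded as \<open>t\<close> and \<open>b\<close> tend to \<open>0\<close>.
\<close>
private definition "S u = sqrt (s0\<^sup>2 - u)"
private definition "b u = sqrt (R\<^sup>2 - s0\<^sup>2 + u)"
private definition "\<beta> u = arccos (S u / R)"
private definition "t u v = sqrt (u - v)"
private definition "\<theta> u v = arccos (S u / S v)"
private definition "N = real_of_int n"
private definition "D u v = \<mu> * (sinh (\<mu> * t u v) / t u v) * cos (N * \<beta> u) * cos (N * \<theta> u v)
   - N * (sin (N * \<beta> u) / b u) * cos (N * \<theta> u v) * cosh (\<mu> * t u v) / S u
   - N * cosh (\<mu> * t u v) * cos (N * \<beta> u) * (sin (N * \<theta> u v) / t u v) / S u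
   + \<mu> * cosh (\<mu> * t u v) * sin (N * \<beta> u) * (sin (N * \<theta> u v) / t u v)
   + N * cos (N * \<beta> u) * (sinh (\<mu> * t u v) * sin (N * \<theta> u v) / b u) / S u
   + N * (sinh (\<mu> * t u v) / t u v) * sin (N * \<beta> u) * cos (N * \<theta> u v) / S u"

private lemma basics:
  assumes "0 \<le> v" "v < u" "u < s0\<^sup>2"
  shows "0 < S u" "S u < S v" "S v \<le> s0" "0 < t u v" "0 < b u" "t u v \<le> b u"
    "(S u)\<^sup>2 = s0\<^sup>2 - u" "(S v)\<^sup>2 = s0\<^sup>2 - v" "(t u v)\<^sup>2 = u - v" "(b u)\<^sup>2 = R\<^sup>2 - s0\<^sup>2 + u"
    "t u v = sqrt ((S v)\<^sup>2 - (S u)\<^sup>2)"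
    "sin (\<beta> u) = b u / R" "sin (\<theta> u v) = t u v / S v"
    "0 < \<theta> u v" "0 < \<beta> u"
proof -
  have R2: "s0\<^sup>2 \<le> R\<^sup>2" using s0 by (intro power_mono) auto
  have R0: "0 < R" using s0 by auto
  show 1: "0 < S u" "S u < S v" "0 < t u v" "0 < b u" "t u v \<le> b u"
    "(S u)\<^sup>2 = s0\<^sup>2 - u" "(S v)\<^sup>2 = s0\<^sup>2 - v" "(t u v)\<^sup>2 = u - v" "(b u)\<^sup>2 = R\<^sup>2 - s0\<^sup>2 + u"
    using assms R2 by (auto simp: S_def t_def b_def)
  show S: "S v \<le> s0" using assms s0 real_sqrt_le_mono[of "s0\<^sup>2 - v" "s0\<^sup>2"] by (auto simp: S_def)
  show t: "t u v = sqrt ((S v)\<^sup>2 - (S u)\<^sup>2)" using 1 by (simp add: t_def)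
  have lt: "S u / R < 1" "S u / S v < 1" "0 < S u / R" "0 < S u / S v" using 1 S s0 R0 by auto
  show "0 < \<theta> u v" "0 < \<beta> u" unfolding \<theta>_def \<beta>_def
    using lt arccos_lt_bounded[of "S u / R"] arccos_lt_bounded[of "S u / S v"] by auto
  have "sin (\<beta> u) = sqrt (1 - (S u / R)\<^sup>2)" unfolding \<beta>_def using lt by (intro sin_arccos) auto
  also have "1 - (S u / R)\<^sup>2 = (R\<^sup>2 - s0\<^sup>2 + u) / R\<^sup>2" using 1 R0 by (simp add: power_divide field_simps)
  finally show "sin (\<beta> u) = b u / R" using R0 by (simp add: b_def real_sqrt_divide)
  have "sin (\<theta> u v) = sqrt (1 - (S u / S v)\<^sup>2)" unfolding \<theta>_def using lt by (intro sin_arccos) auto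
  also have "1 - (S u / S v)\<^sup>2 = ((S v)\<^sup>2 - (S u)\<^sup>2) / (S v)\<^sup>2" using 1(1,2) by (simp add: power_divide diff_divide_distrib)
  finally show "sin (\<theta> u v) = t u v / S v" unfolding t using 1(1,2) by (simp add: real_sqrt_divide)
qed

private lemma kernel_form:
  assumes "0 \<le> v" "v < u" "u < s0\<^sup>2"
  shows "kernel_K R \<mu> n (S u) (S v) = 2 * (cosh (\<mu> * t u v) * cos (N * \<beta> u) * cos (N * \<theta> u v)
           + sinh (\<mu> * t u v) * sin (N * \<beta> u) * sin (N * \<theta> u v))"
  using kernel_K_eq(2)[of "S u" "S v" R \<mu> n] basics(1-3)[OF assms] s0
  unfolding basics(11)[OF assms] \<beta>_def \<theta>_def N_def by linarith

private lemma kernel_deriv: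
  assumes uv: "0 \<le> v" "v < u" "u < s0\<^sup>2"
  shows "((\<lambda>u. kernel_K R \<mu> n (S u) (S v)) has_real_derivative D u v) (at u)"
proof -
  note B = basics[OF uv]
  have R0: "0 < R" using s0 by auto
  have dS: "(S has_real_derivative - 1 / (2 * S u)) (at u)"
    unfolding S_def using uv by (auto intro!: derivative_eq_intros simp: field_simps)
  have dt: "((\<lambda>u. t u v) has_real_derivative 1 / (2 * t u v)) (at u)"
    unfolding t_def using uv by (auto intro!: derivative_eq_intros simp: field_simps)
  have d\<beta>: "(\<beta> has_real_derivative 1 / (2 * S u * b u)) (at u)"
  proof -
    have q: "0 < S u / R" "S u / R < 1" using B(1-3) R0 s0 by simp_all
    from q have "-1 < S u / R" by linarith
    with q have "(\<beta> has_real_derivative (- 1 / (2 * S u)) / R * inverse (- sqrt (1 - (S u / R)\<^sup>2))) (at u)"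
      unfolding \<beta>_def using R0 by (auto intro!: derivative_eq_intros dS)
    also have "sqrt (1 - (S u / R)\<^sup>2) = b u / R"
      using B(12) q \<open>-1 < S u / R\<close> by (simp add: \<beta>_def sin_arccos)
    finally show ?thesis using R0 B(1,5) by (simp add: field_simps)
  qed
  have d\<theta>: "((\<lambda>u. \<theta> u v) has_real_derivative 1 / (2 * t u v * S u)) (at u)"
  proof -
    have q: "0 < S u / S v" "S u / S v < 1" using B(1,2) by simp_all
    from q have "-1 < S u / S v" by linarith
    with q have "((\<lambda>u. \<theta> u v) has_real_derivative (- 1 / (2 * S u)) / S v * inverse (- sqrt (1 - (S u / S v)\<^sup>2))) (at u)"
      unfolding \<theta>_def using B(1,2) by (auto intro!: derivative_eq_intros dS)
    also have "sqrt (1 - (S u / S v)\<^sup>2) = t u v / S v"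
      using B(13) q \<open>-1 < S u / S v\<close> by (simp add: \<theta>_def sin_arccos)
    finally show ?thesis using B(1,2,4) by (simp add: field_simps)
  qed
  define i j l where "i = 1 / t u v" and "j = 1 / S u" and "l = 1 / b u"
  have dt': "((\<lambda>u. t u v) has_real_derivative i / 2) (at u)" using dt by (simp add: i_def mult.commute)
  have d\<beta>': "(\<beta> has_real_derivative j * l / 2) (at u)" using d\<beta> by (simp add: j_def l_def mult_ac)
  have d\<theta>': "((\<lambda>u. \<theta> u v) has_real_derivative i * j / 2) (at u)" using d\<theta> by (simp add: i_def j_def mult_ac)
  have Deq: "D u v = \<mu> * (sinh (\<mu> * t u v) * i) * cos (N * \<beta> u) * cos (N * \<theta> u v)
     - N * (sin (N * \<beta> u) * l) * cos (N * \<theta> u v) * cosh (\<mu> * t u v) * j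
     - N * cosh (\<mu> * t u v) * cos (N * \<beta> u) * (sin (N * \<theta> u v) * i) * j
     + \<mu> * cosh (\<mu> * t u v) * sin (N * \<beta> u) * (sin (N * \<theta> u v) * i)
     + N * cos (N * \<beta> u) * (sinh (\<mu> * t u v) * sin (N * \<theta> u v) * l) * j
     + N * (sinh (\<mu> * t u v) * i) * sin (N * \<beta> u) * cos (N * \<theta> u v) * j"
    unfolding D_def i_def j_def l_def by simp
  have "((\<lambda>u. 2 * (cosh (\<mu> * t u v) * cos (N * \<beta> u) * cos (N * \<theta> u v)
           + sinh (\<mu> * t u v) * sin (N * \<beta> u) * sin (N * \<theta> u v))) has_real_derivative D u v) (at u)"
    apply (rule derivative_eq_intros dt' d\<beta>' d\<theta>' refl)+
    unfolding Deq by algebra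
  moreover have "eventually (\<lambda>w. kernel_K R \<mu> n (S w) (S v) = 2 * (cosh (\<mu> * t w v) * cos (N * \<beta> w) * cos (N * \<theta> w v)
           + sinh (\<mu> * t w v) * sin (N * \<beta> w) * sin (N * \<theta> w v))) (nhds u)"
    by (rule eventually_nhds_in_open[of "{v<..<s0\<^sup>2}" u, THEN eventually_mono])
       (use uv kernel_form in auto)
  ultimately show ?thesis
    by (subst DERIV_cong_ev[OF refl _ refl]) auto
qed

text \<open>
  The limit of \<open>D\<close> at the corner \<open>u = v = 0\<close>, where \<open>\<omega>\<close> stands for the limit of \<open>sin (N * \<beta> u) / b u\<close>.
\<close>
private definition "\<kappa> \<omega> = \<mu>\<^sup>2 * cos (N * \<beta> 0) - N * \<omega> / s0 - N\<^sup>2 * cos (N * \<beta> 0) / s0\<^sup>2 + 2 * \<mu> * N * sin (N * \<beta> 0) / s0"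

text \<open>
  Each factor converges at the corner \<open>u = v = 0\<close>, where \<open>t\<close> and \<open>\<theta>\<close> tend to \<open>0\<close>.  The one delicate
  factor is \<open>sin (N * \<beta> u) / b u\<close>: its limit \<open>\<omega>\<close> is a parameter, because \<open>b\<close> tends to \<open>0\<close>
  when \<open>s\<^sub>0 = R\<close>.
\<close>
private lemma kernel_deriv_tendsto:
  assumes \<omega>: "((\<lambda>u. sin (N * \<beta> u) / b u) \<longlongrightarrow> \<omega>) (at_right 0)"
  shows "((\<lambda>(u,v). D u v) \<longlongrightarrow> \<kappa> \<omega>) (at (0,0) within {(u,v). 0 \<le> v \<and> v < u})"
proof -
  define F where "F = at (0::real,0::real) within {(u,v). 0 \<le> v \<and> v < u}"
  have R0: "0 < R" using s0 by auto
  have id: "((\<lambda>z. z) \<longlongrightarrow> (0,0)) F" unfolding F_def by (rule tendsto_ident_at)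
  have u0: "(fst \<longlongrightarrow> 0) F" and v0: "(snd \<longlongrightarrow> 0) F"
    using tendsto_fst[OF id] tendsto_snd[OF id] by auto
  have dom: "eventually (\<lambda>z. 0 \<le> snd z \<and> snd z < fst z) F"
    unfolding F_def by (simp add: eventually_at_filter case_prod_unfold)
  have ev: "eventually (\<lambda>z. 0 \<le> snd z \<and> snd z < fst z \<and> fst z < s0\<^sup>2) F"
    using dom order_tendstoD(2)[OF u0, of "s0\<^sup>2"] s0 by (auto elim: eventually_elim2)
  have ur: "filterlim fst (at_right 0) F"
    unfolding filterlim_at using u0 dom by (auto elim: eventually_mono)
  have "isCont S 0" unfolding S_def by (intro continuous_intros)
  then have Su: "((\<lambda>z. S (fst z)) \<longlongrightarrow> s0) F" and Sv: "((\<lambda>z. S (snd z)) \<longlongrightarrow> s0) F"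
    using isCont_tendsto_compose[OF _ u0, of S] isCont_tendsto_compose[OF _ v0, of S] s0 by (auto simp: S_def)
  have t0: "((\<lambda>z. t (fst z) (snd z)) \<longlongrightarrow> 0) F"
    unfolding t_def using tendsto_real_sqrt[OF tendsto_diff[OF u0 v0]] by simp
  have ta: "filterlim (\<lambda>z. t (fst z) (snd z)) (at 0) F"
    unfolding filterlim_at
  proof
    show "eventually (\<lambda>z. t (fst z) (snd z) \<in> UNIV \<and> t (fst z) (snd z) \<noteq> 0) F"
      using ev
    proof eventually_elim
      case (elim z)
      then show ?case using basics(4)[of "snd z" "fst z"] by simp
    qed
  qed (rule t0)
  have th0: "((\<lambda>z. \<theta> (fst z) (snd z)) \<longlongrightarrow> 0) F"
  proof -
    have q: "((\<lambda>z. S (fst z) / S (snd z)) \<longlongrightarrow> 1) F"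
      using s0 tendsto_divide[OF Su Sv] by simp
    have "((\<lambda>z. arccos (S (fst z) / S (snd z))) \<longlongrightarrow> arccos 1) F"
    proof (rule continuous_on_tendsto_compose[OF continuous_on_arccos' q])
      show "eventually (\<lambda>z. S (fst z) / S (snd z) \<in> {-1..1}) F"
        using ev
      proof eventually_elim
        case (elim z)
        then have "0 < S (fst z)" "S (fst z) < S (snd z)" using basics(1,2)[of "snd z" "fst z"] by simp_all
        then show ?case by (simp add: le_divide_eq)
      qed
    qed auto
    then show ?thesis by (simp add: \<theta>_def)
  qed
  have tha: "filterlim (\<lambda>z. \<theta> (fst z) (snd z)) (at 0) F"
    unfolding filterlim_at
  proof
    show "eventually (\<lambda>z. \<theta> (fst z) (snd z) \<in> UNIV \<and> \<theta> (fst z) (snd z) \<noteq> 0) F"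
      using ev
    proof eventually_elim
      case (elim z)
      then show ?case using basics(14)[of "snd z" "fst z"] by simp
    qed
  qed (rule th0)
  have b0: "((\<lambda>z. \<beta> (fst z)) \<longlongrightarrow> \<beta> 0) F"
  proof -
    have q: "((\<lambda>z. S (fst z) / R) \<longlongrightarrow> s0 / R) F"
      using R0 by (intro tendsto_divide Su) auto
    have "((\<lambda>z. arccos (S (fst z) / R)) \<longlongrightarrow> arccos (s0 / R)) F"
    proof (rule continuous_on_tendsto_compose[OF continuous_on_arccos' q])
      show "eventually (\<lambda>z. S (fst z) / R \<in> {-1..1}) F"
        using ev
      proof eventually_elim
        case (elim z)
        then have "0 < S (fst z)" "S (fst z) \<le> R" using basics(1-3)[of "snd z" "fst z"] s0 by simp_all
        then show ?case by (simp add: le_divide_eq)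
      qed
      have "0 \<le> s0 / R" "s0 / R \<le> 1" using s0 by auto
      then show "s0 / R \<in> {-1..1}" by simp
    qed
    then show ?thesis using s0 by (simp add: \<beta>_def S_def)
  qed
  have shq: "((\<lambda>z. sinh (\<mu> * t (fst z) (snd z)) / t (fst z) (snd z)) \<longlongrightarrow> \<mu>) F"
    by (rule filterlim_compose[OF tendsto_sinh_mult_over ta])
  have sq: "((\<lambda>z. sin (N * \<theta> (fst z) (snd z)) / t (fst z) (snd z)) \<longlongrightarrow> N / s0) F"
  proof -
    have "((\<lambda>z. sin (N * \<theta> (fst z) (snd z)) / sin (\<theta> (fst z) (snd z)) / S (snd z)) \<longlongrightarrow> N / s0) F"
      using s0 by (intro tendsto_divide Sv filterlim_compose[OF tendsto_sin_mult_over_sin tha]) auto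
    moreover have "eventually (\<lambda>z. sin (N * \<theta> (fst z) (snd z)) / sin (\<theta> (fst z) (snd z)) / S (snd z)
        = sin (N * \<theta> (fst z) (snd z)) / t (fst z) (snd z)) F"
      using ev
    proof eventually_elim
      case (elim z)
      then show ?case using basics(13)[of "snd z" "fst z"] basics(1,2)[of "snd z" "fst z"] by simp
    qed
    ultimately show ?thesis by (rule Lim_transform_eventually)
  qed
  \<comment> \<open>This quotient compensates the factor \<open>1 / b\<close>, since \<open>t \<le> b\<close>.\<close>
  have tb: "((\<lambda>z. (t (fst z) (snd z))\<^sup>2 / b (fst z)) \<longlongrightarrow> 0) F"
  proof (rule Lim_null_comparison[OF _ t0])
    show "eventually (\<lambda>z. norm ((t (fst z) (snd z))\<^sup>2 / b (fst z)) \<le> t (fst z) (snd z)) F"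
      using ev
    proof eventually_elim
      case (elim z)
      then have "0 < t (fst z) (snd z)" "0 < b (fst z)" "t (fst z) (snd z) \<le> b (fst z)"
        using basics(4-6)[of "snd z" "fst z"] by simp_all
      then show ?case by (simp add: power2_eq_square divide_le_eq)
    qed
  qed
  have tb': "((\<lambda>z. sinh (\<mu> * t (fst z) (snd z)) * sin (N * \<theta> (fst z) (snd z)) / b (fst z)) \<longlongrightarrow> 0) F"
  proof (rule Lim_transform_eventually)
    show "((\<lambda>z. sinh (\<mu> * t (fst z) (snd z)) / t (fst z) (snd z) * (sin (N * \<theta> (fst z) (snd z)) / t (fst z) (snd z))
        * ((t (fst z) (snd z))\<^sup>2 / b (fst z))) \<longlongrightarrow> 0) F"
      using tendsto_mult[OF tendsto_mult[OF shq sq] tb] by simp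
    show "eventually (\<lambda>z. sinh (\<mu> * t (fst z) (snd z)) / t (fst z) (snd z) * (sin (N * \<theta> (fst z) (snd z)) / t (fst z) (snd z))
        * ((t (fst z) (snd z))\<^sup>2 / b (fst z)) = sinh (\<mu> * t (fst z) (snd z)) * sin (N * \<theta> (fst z) (snd z)) / b (fst z)) F"
      using ev
    proof eventually_elim
      case (elim z)
      then have "t (fst z) (snd z) > 0" using basics(4) by simp
      then show ?case by (simp add: power2_eq_square)
    qed
  qed
  have wq: "((\<lambda>z. sin (N * \<beta> (fst z)) / b (fst z)) \<longlongrightarrow> \<omega>) F"
    by (rule filterlim_compose[OF \<omega> ur])
  have ch: "((\<lambda>z. cosh (\<mu> * t (fst z) (snd z))) \<longlongrightarrow> cosh (\<mu> * 0)) F"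
    by (intro tendsto_intros t0)
  have "((\<lambda>z. D (fst z) (snd z)) \<longlongrightarrow>
     \<mu> * \<mu> * cos (N * \<beta> 0) * cos (N * 0) - N * \<omega> * cos (N * 0) * cosh (\<mu> * 0) / s0
     - N * cosh (\<mu> * 0) * cos (N * \<beta> 0) * (N / s0) / s0 + \<mu> * cosh (\<mu> * 0) * sin (N * \<beta> 0) * (N / s0)
     + N * cos (N * \<beta> 0) * 0 / s0 + N * \<mu> * sin (N * \<beta> 0) * cos (N * 0) / s0) F"
    unfolding D_def using s0 by (intro tendsto_intros shq b0 th0 wq ch Su sq tb') auto
  then show ?thesis unfolding F_def \<kappa>_def
    by (simp add: case_prod_unfold power2_eq_square algebra_simps)
qed

text \<open>
  The derivative converges to \<open>\<kappa> \<omega>\<close> at the corner, so the mean value theorem bounds the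
  difference quotients near it, also those that start on the diagonal, where the formula for
  the derivative does not apply.
\<close>
private lemma kernel_strict_derivative:
  assumes \<omega>: "((\<lambda>u. sin (N * \<beta> u) / b u) \<longlongrightarrow> \<omega>) (at_right 0)"
    and \<epsilon>: "0 < \<epsilon>"
  shows "\<exists>\<delta>>0. \<forall>v u u'. 0 \<le> v \<longrightarrow> v \<le> u \<longrightarrow> u \<le> u' \<longrightarrow> u' \<le> \<delta> \<longrightarrow>
     \<bar>kernel_K R \<mu> n (S u') (S v) - kernel_K R \<mu> n (S u) (S v) - \<kappa> \<omega> * (u' - u)\<bar> \<le> \<epsilon> * (u' - u)"
proof -
  have "eventually (\<lambda>z. dist (case z of (u,v) \<Rightarrow> D u v) (\<kappa> \<omega>) < \<epsilon>) (at (0,0) within {(u,v). 0 \<le> v \<and> v < u})"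
    using kernel_deriv_tendsto[OF \<omega>] \<epsilon> by (auto dest: tendstoD)
  then obtain d where d: "d > 0" "\<And>u v. 0 \<le> v \<Longrightarrow> v < u \<Longrightarrow> dist (u,v) (0,0) < d \<Longrightarrow> \<bar>D u v - \<kappa> \<omega>\<bar> < \<epsilon>"
    unfolding eventually_at by (force simp: dist_real_def)
  define \<delta> where "\<delta> = min (d / 3) (s0\<^sup>2 / 2)"
  have \<delta>: "0 < \<delta>" "\<delta> < s0\<^sup>2" "2 * \<delta> < d" using d s0 by (auto simp: \<delta>_def min_def)
  have "\<bar>kernel_K R \<mu> n (S u') (S v) - kernel_K R \<mu> n (S u) (S v) - \<kappa> \<omega> * (u' - u)\<bar> \<le> \<epsilon> * (u' - u)"
    if h: "0 \<le> v" "v \<le> u" "u \<le> u'" "u' \<le> \<delta>" for v u u'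
  proof (cases "u = u'")
    case False
    define f where "f = (\<lambda>w. kernel_K R \<mu> n (S w) (S v) - \<kappa> \<omega> * w)"
    have Spos: "0 < S w" "S w \<le> S v" "S v \<le> R" if "w \<in> {v..\<delta>}" for w
    proof -
      show "0 < S w" "S w \<le> S v" using that \<delta> h by (auto simp: S_def)
      have "S v \<le> sqrt (s0\<^sup>2)" unfolding S_def using h by (intro real_sqrt_le_mono) auto
      then show "S v \<le> R" using s0 by simp
    qed
    have "continuous_on {u..u'} (\<lambda>w. (\<lambda>(s,r). kernel_K R \<mu> n s r) (S w, S v))"
    proof (rule continuous_on_compose2[OF continuous_on_kernel_K])
      show "continuous_on {u..u'} (\<lambda>w. (S w, S v))" unfolding S_def by (intro continuous_intros)
      show "(\<lambda>w. (S w, S v)) ` {u..u'} \<subseteq> {(s, r). 0 < s \<and> s \<le> r \<and> r \<le> R}"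
        using Spos Spos(3)[of u] h by auto
    qed
    then have cf: "continuous_on {u..u'} f" unfolding f_def by (auto intro!: continuous_intros)
    have df: "(f has_real_derivative D w v - \<kappa> \<omega>) (at w)" if "u < w" "w < u'" for w
      unfolding f_def using that h \<delta>
      by (auto intro!: derivative_eq_intros kernel_deriv)
    have "u < u'" using False h by auto
    then obtain w where w: "u < w" "w < u'" "f u' - f u = (u' - u) * (D w v - \<kappa> \<omega>)"
      using MVT[OF _ cf] df by (metis DERIV_unique real_differentiable_def)
    have "dist (w,v) (0,0) \<le> w + v"
      using w h sqrt_sum_squares_le_sum[of w v] by (simp add: dist_Pair_Pair)
    then have "\<bar>D w v - \<kappa> \<omega>\<bar> \<le> \<epsilon>" using d(2)[of v w] w h \<delta> by auto
    then have "\<bar>(u' - u) * (D w v - \<kappa> \<omega>)\<bar> \<le> (u' - u) * \<epsilon>"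
      using w by (simp add: abs_mult)
    then show ?thesis unfolding w(3)[symmetric] by (simp add: f_def algebra_simps)
  qed (use \<epsilon> in simp)
  then show ?thesis using \<delta> by blast
qed

text \<open>
  At \<open>s\<^sub>0 = R\<close> the derivative of \<open>\<beta>\<close> blows up like \<open>1 / b\<close>, but \<open>sin (n \<beta>)\<close> vanishes at the same rate.
\<close>
lemma kernel_lipschitz:
  "\<exists>L. \<exists>\<delta>>0. \<forall>v u u'. 0 \<le> v \<longrightarrow> v \<le> u \<longrightarrow> u \<le> u' \<longrightarrow> u' \<le> \<delta> \<longrightarrow>
     \<bar>kernel_K R \<mu> n (sqrt (s0\<^sup>2 - u')) (sqrt (s0\<^sup>2 - v)) - kernel_K R \<mu> n (sqrt (s0\<^sup>2 - u)) (sqrt (s0\<^sup>2 - v))\<bar>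
       \<le> L * (u' - u)"
proof -
  have "\<exists>\<omega>. ((\<lambda>u. sin (N * \<beta> u) / b u) \<longlongrightarrow> \<omega>) (at_right 0)"
  proof (cases "s0 = R")
    case True
    have R0: "0 < R" using s0 by simp
    have ev: "eventually (\<lambda>u. 0 < u \<and> u < s0\<^sup>2) (at_right 0)"
      using eventually_at_right_real[of 0 "s0\<^sup>2"] s0 by (simp add: eventually_mono)
    have "((\<lambda>u. arccos (sqrt (s0\<^sup>2 - u) / R)) \<longlongrightarrow> arccos 1) (at_right 0)"
    proof (rule continuous_on_tendsto_compose[OF continuous_on_arccos'])
      have "((\<lambda>u. sqrt (s0\<^sup>2 - u) / R) \<longlongrightarrow> sqrt (s0\<^sup>2 - 0) / R) (at_right 0)"
        using R0 by (intro tendsto_intros) auto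
      then show "((\<lambda>u. sqrt (s0\<^sup>2 - u) / R) \<longlongrightarrow> 1) (at_right 0)" using True R0 by simp
      show "eventually (\<lambda>u. sqrt (s0\<^sup>2 - u) / R \<in> {-1..1}) (at_right 0)"
        using ev
      proof eventually_elim
        case (elim u)
        then have "0 < S u" "S u \<le> R" using basics(1-3)[of 0 u] s0 by simp_all
        then have "0 \<le> S u / R" "S u / R \<le> 1" using R0 by auto
        then show ?case by (simp add: S_def)
      qed
    qed auto
    then have "(\<beta> \<longlongrightarrow> 0) (at_right 0)" by (simp add: \<beta>_def[abs_def] S_def)
    moreover have "eventually (\<lambda>u. \<beta> u \<noteq> 0) (at_right 0)"
      using ev
    proof eventually_elim
      case (elim u)
      then show ?case using basics(15)[of 0 u] by simp
    qed
    ultimately have "filterlim \<beta> (at 0) (at_right 0)" by (simp add: filterlim_at)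
    then have "((\<lambda>u. sin (N * \<beta> u) / sin (\<beta> u) / R) \<longlongrightarrow> N / R) (at_right 0)"
      using R0 by (intro tendsto_divide filterlim_compose[OF tendsto_sin_mult_over_sin] tendsto_const) auto
    moreover have "eventually (\<lambda>u. sin (N * \<beta> u) / sin (\<beta> u) / R = sin (N * \<beta> u) / b u) (at_right 0)"
      using ev
    proof eventually_elim
      case (elim u)
      then show ?case using basics(12)[of 0 u] R0 by simp
    qed
    ultimately have "((\<lambda>u. sin (N * \<beta> u) / b u) \<longlongrightarrow> N / R) (at_right 0)"
      by (rule Lim_transform_eventually)
    then show ?thesis by blast
  next
    case False
    then have lt: "s0 / R < 1" "-1 < s0 / R" "s0\<^sup>2 < R\<^sup>2" using s0 by (auto simp: field_simps power_strict_mono)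
    have "isCont (\<lambda>u. sin (N * \<beta> u) / b u) 0"
      unfolding \<beta>_def S_def b_def using s0 lt
      by (intro continuous_intros isCont_o2[OF _ isCont_arccos]) auto
    then show ?thesis unfolding isCont_def by (blast intro: tendsto_mono[OF at_le[OF subset_UNIV]])
  qed
  then obtain \<omega> where \<omega>: "((\<lambda>u. sin (N * \<beta> u) / b u) \<longlongrightarrow> \<omega>) (at_right 0)" by blast
  obtain \<delta> where \<delta>: "\<delta> > 0" "\<And>v u u'. 0 \<le> v \<Longrightarrow> v \<le> u \<Longrightarrow> u \<le> u' \<Longrightarrow> u' \<le> \<delta> \<Longrightarrow>
     \<bar>kernel_K R \<mu> n (S u') (S v) - kernel_K R \<mu> n (S u) (S v) - \<kappa> \<omega> * (u' - u)\<bar> \<le> 1 * (u' - u)"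
    using kernel_strict_derivative[OF \<omega>, of 1] by auto
  have "\<bar>kernel_K R \<mu> n (S u') (S v) - kernel_K R \<mu> n (S u) (S v)\<bar> \<le> (\<bar>\<kappa> \<omega>\<bar> + 1) * (u' - u)"
    if "0 \<le> v" "v \<le> u" "u \<le> u'" "u' \<le> \<delta>" for v u u'
  proof -
    have "\<bar>\<kappa> \<omega> * (u' - u)\<bar> = \<bar>\<kappa> \<omega>\<bar> * (u' - u)" using that by (simp add: abs_mult)
    then show ?thesis using \<delta>(2)[OF that] by (simp add: distrib_right)
  qed
  then show ?thesis using \<delta>(1) unfolding S_def by blast
qed

text \<open>
  At a zero of the diagonal only the terms with \<open>\<sigma> = sin (n arccos (s\<^sub>0 / R))\<close> survive in the slope of the
  kernel.
\<close>
lemma kernel_strict_derivative_at_zero: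
  assumes "s0 < R" and c0: "cos (of_int n * arccos (s0 / R)) = 0" and \<epsilon>: "0 < \<epsilon>"
  defines "\<sigma> \<equiv> sin (of_int n * arccos (s0 / R))"
  shows "\<exists>\<delta>>0. \<forall>v u u'. 0 \<le> v \<longrightarrow> v \<le> u \<longrightarrow> u \<le> u' \<longrightarrow> u' \<le> \<delta> \<longrightarrow>
     \<bar>kernel_K R \<mu> n (sqrt (s0\<^sup>2 - u')) (sqrt (s0\<^sup>2 - v)) - kernel_K R \<mu> n (sqrt (s0\<^sup>2 - u)) (sqrt (s0\<^sup>2 - v))
        - of_int n * \<sigma> / s0 * (2 * \<mu> - 1 / sqrt (R\<^sup>2 - s0\<^sup>2)) * (u' - u)\<bar> \<le> \<epsilon> * (u' - u)"
proof -
  have lt: "s0 / R < 1" "-1 < s0 / R" "s0\<^sup>2 < R\<^sup>2" using s0 assms(1) by (auto simp: field_simps power_strict_mono)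
  have "isCont (\<lambda>u. sin (N * \<beta> u) / b u) 0"
    unfolding \<beta>_def S_def b_def using s0 lt
    by (intro continuous_intros isCont_o2[OF _ isCont_arccos]) auto
  then have "((\<lambda>u. sin (N * \<beta> u) / b u) \<longlongrightarrow> sin (N * \<beta> 0) / b 0) (at_right 0)"
    unfolding isCont_def by (rule tendsto_mono[OF at_le[OF subset_UNIV]])
  note * = kernel_strict_derivative[OF this \<epsilon>]
  have e: "N * \<beta> 0 = of_int n * arccos (s0 / R)" "b 0 = sqrt (R\<^sup>2 - s0\<^sup>2)"
    using s0 by (auto simp: N_def \<beta>_def S_def b_def)
  have "\<kappa> (sin (N * \<beta> 0) / b 0) = of_int n * \<sigma> / s0 * (2 * \<mu> - 1 / sqrt (R\<^sup>2 - s0\<^sup>2))"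
    unfolding \<kappa>_def e c0 \<sigma>_def by (simp add: N_def algebra_simps)
  from *[unfolded this S_def] show ?thesis .
qed

lemma kernel_diagonal_derivative:
  assumes "s0 < R" and "0 < a" "a < s0\<^sup>2"
  shows "((\<lambda>u. kernel_K R \<mu> n (sqrt (s0\<^sup>2 - u)) (sqrt (s0\<^sup>2 - u))) has_real_derivative
     - (of_int n * sin (of_int n * arccos (s0 / R)) / (s0 * sqrt (R\<^sup>2 - s0\<^sup>2)))) (at 0 within {0..a})"
proof -
  have lt: "s0 / R < 1" "-1 < s0 / R" "s0\<^sup>2 < R\<^sup>2" using s0 assms(1) by (auto simp: field_simps power_strict_mono)
  have R0: "0 < R" using s0 by simp
  have sq: "sqrt (1 - (s0 / R)\<^sup>2) = sqrt (R\<^sup>2 - s0\<^sup>2) / R"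
  proof -
    have "1 - (s0 / R)\<^sup>2 = (R\<^sup>2 - s0\<^sup>2) / R\<^sup>2" using R0 by (simp add: power_divide diff_divide_distrib)
    then show ?thesis using R0 by (simp add: real_sqrt_divide)
  qed
  define w where "w = sqrt (R\<^sup>2 - s0\<^sup>2)"
  have w: "w > 0" using lt by (simp add: w_def)
  have S0: "S 0 = s0" using s0 by (simp add: S_def)
  have dS: "(S has_real_derivative - 1 / (2 * s0)) (at 0)"
    unfolding S_def[abs_def] using s0 by (auto intro!: derivative_eq_intros simp: field_simps)
  have "((\<lambda>u. arccos (S u / R)) has_real_derivative (- 1 / (2 * s0)) / R * inverse (- sqrt (1 - (s0 / R)\<^sup>2))) (at 0)"
    using R0 lt by (auto intro!: derivative_eq_intros dS simp: S0)
  also have "(- 1 / (2 * s0)) / R * inverse (- sqrt (1 - (s0 / R)\<^sup>2)) = 1 / (2 * s0 * w)"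
    unfolding sq w_def[symmetric] using R0 s0 w by (simp add: field_simps)
  finally have dA: "((\<lambda>u. arccos (S u / R)) has_real_derivative 1 / (2 * s0 * w)) (at 0)" .
  define A where "A = (\<lambda>u. arccos (S u / R))"
  have A0: "A 0 = arccos (s0 / R)" by (simp add: A_def S0)
  have "((\<lambda>u. 2 * cos (of_int n * A u)) has_real_derivative
      2 * (- (1 / (2 * s0 * w) * of_int n * sin (of_int n * arccos (s0 / R))))) (at 0)"
    by (auto intro!: derivative_eq_intros dA[folded A_def] simp: A0)
  also have "2 * (- (1 / (2 * s0 * w) * of_int n * sin (of_int n * arccos (s0 / R))))
      = - (of_int n * sin (of_int n * arccos (s0 / R)) / (s0 * w))"
    by simp
  finally have "((\<lambda>u. 2 * cos (of_int n * arccos (sqrt (s0\<^sup>2 - u) / R))) has_real_derivative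
     - (of_int n * sin (of_int n * arccos (s0 / R)) / (s0 * sqrt (R\<^sup>2 - s0\<^sup>2)))) (at 0)"
    unfolding A_def S_def w_def .
  then have d: "((\<lambda>u. 2 * cos (of_int n * arccos (sqrt (s0\<^sup>2 - u) / R))) has_real_derivative
     - (of_int n * sin (of_int n * arccos (s0 / R)) / (s0 * sqrt (R\<^sup>2 - s0\<^sup>2)))) (at 0 within {0..a})"
    by (rule has_field_derivative_at_within)
  show ?thesis
  proof (rule has_field_derivative_transform_within[OF d, of a])
    fix u assume u: "u \<in> {0..a}"
    have "sqrt (s0\<^sup>2 - u) \<le> sqrt (s0\<^sup>2)" using u by (intro real_sqrt_le_mono) auto
    then show "2 * cos (of_int n * arccos (sqrt (s0\<^sup>2 - u) / R)) = kernel_K R \<mu> n (sqrt (s0\<^sup>2 - u)) (sqrt (s0\<^sup>2 - u))"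
      using u assms s0 by (subst kernel_K_diagonal) auto
  qed (use assms in auto)
qed

end

section \<open>Uniqueness for the homogeneous equation\<close>

lemma set_integral_eq_indicator:
  "(LBINT x:S. f x) = (LBINT x. f x * indicator S x)" for f :: "real \<Rightarrow> real"
  by (simp add: set_lebesgue_integral_def mult.commute)

text \<open>
  The same weakly singular integral is written in \<open>w = r\<^sup>2\<close> (Abel form), in the radius \<open>r\<close>
  (the form of the integral equation) and, in the next lemma, in the position \<open>t\<close> along the chord
  (the form of the transform), where the singularity disappears.
\<close>
lemma weakly_singular_integral_radius:
  fixes q :: "real \<Rightarrow> real"
  assumes "0 < s" "s \<le> b" and cont: "continuous_on {s\<^sup>2..b\<^sup>2} q"
  shows "(LBINT w:{s\<^sup>2..b\<^sup>2}. q w / sqrt (w - s\<^sup>2)) = (LBINT r:{s..b}. q (r\<^sup>2) / sqrt (r\<^sup>2 - s\<^sup>2) * (2 * r))"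
  unfolding set_integral_eq_indicator
  using set_integrable_weakly_singular[OF cont] assms
  by (intro integral_substitution(2)) (auto intro!: derivative_eq_intros continuous_intros simp: field_simps)

lemma weakly_singular_integral_chord:
  fixes q :: "real \<Rightarrow> real"
  assumes "A \<le> B" and cont: "continuous_on {A..B} q"
  shows "(LBINT w:{A..B}. q w / sqrt (w - A)) = (LBINT t:{0..sqrt (B - A)}. 2 * q (A + t\<^sup>2))"
proof -
  define b where "b = sqrt (B - A)"
  have b: "0 \<le> b" "A + b\<^sup>2 = B" using assms by (auto simp: b_def)
  have "(LBINT w. q w / sqrt (w - A) * indicator {A + 0\<^sup>2..A + b\<^sup>2} w)
      = (LBINT t. q (A + t\<^sup>2) / sqrt (A + t\<^sup>2 - A) * (2 * t) * indicator {0..b} t)"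
    using set_integrable_weakly_singular[OF cont] b
    by (intro integral_substitution(2)) (auto intro!: derivative_eq_intros continuous_intros simp: field_simps)
  also have "\<dots> = (LBINT t. 2 * q (A + t\<^sup>2) * indicator {0..b} t)"
  proof (rule integral_cong_AE)
    have "continuous_on {0..b} (\<lambda>t. q (A + t\<^sup>2))"
      using b by (intro continuous_on_compose2[OF cont] continuous_intros) (auto intro!: power_mono)
    from borel_measurable_continuous_on_indicator[OF _ this]
    have m: "(\<lambda>t. indicator {0..b} t *\<^sub>R q (A + t\<^sup>2)) \<in> borel_measurable lborel" by simp
    have "(\<lambda>t. (indicator {0..b} t *\<^sub>R q (A + t\<^sup>2)) * (1 / sqrt (A + t\<^sup>2 - A) * (2 * t))) \<in> borel_measurable lborel"
      by (intro borel_measurable_times m) measurable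
    then show "(\<lambda>t. q (A + t\<^sup>2) / sqrt (A + t\<^sup>2 - A) * (2 * t) * indicator {0..b} t) \<in> borel_measurable lborel"
      by (simp add: mult_ac)
    have "(\<lambda>t. 2 * (indicator {0..b} t *\<^sub>R q (A + t\<^sup>2))) \<in> borel_measurable lborel"
      by (intro borel_measurable_times m) measurable
    then show "(\<lambda>t. 2 * q (A + t\<^sup>2) * indicator {0..b} t) \<in> borel_measurable lborel"
      by (simp add: mult_ac)
    show "AE t in lborel. q (A + t\<^sup>2) / sqrt (A + t\<^sup>2 - A) * (2 * t) * indicator {0..b} t
        = 2 * q (A + t\<^sup>2) * indicator {0..b} t"
      using AE_lborel_singleton[of "0::real"]
      by eventually_elim (auto split: split_indicator)
  qed
  finally show ?thesis
    unfolding set_integral_eq_indicator b_def[symmetric] by (simp only: b zero_power2 add_0_right)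
qed

lemma set_integral_reflect:
  fixes F :: "real \<Rightarrow> real"
  shows "(LBINT w:{c - b..c - a}. F w) = (LBINT v:{a..b}. F (c - v))"
proof -
  have "(LBINT w. indicator {c - b..c - a} w *\<^sub>R F w)
      = \<bar>-1\<bar> *\<^sub>R (LBINT v. indicator {c - b..c - a} (c + (-1) * v) *\<^sub>R F (c + (-1) * v))"
    by (rule lborel_integral_real_affine) simp
  also have "\<dots> = (LBINT v. indicator {a..b} v *\<^sub>R F (c - v))"
    by (auto intro!: Bochner_Integration.integral_cong split: split_indicator)
  finally show ?thesis by (simp add: set_lebesgue_integral_def)
qed

text \<open>
  The regular case applies unless \<open>s\<^sub>0\<close> is a zero of the diagonal of the kernel.  At a zero,
  \<open>p = \<kappa> / (2 c) = (1 - 2 \<mu> w) / 2\<close> with \<open>w = sqrt (R\<^sup>2 - s\<^sub>0\<^sup>2) < R\<close>, so \<open>p > - 1\<close> amounts to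
  \<open>\<mu> w < 3 / 2\<close>.
\<close>
lemma homogeneous_equation_local_uniqueness:
  fixes d :: "real \<Rightarrow> real"
  assumes R: "0 < R" and \<mu>: "\<mu> * R \<le> 3 / 2"
    and cont: "continuous_on {0..R} d"
    and eq: "\<And>s. 0 < s \<Longrightarrow> s < R \<Longrightarrow> (LBINT r:{s..R}. d r * (r * kernel_K R \<mu> n s r / sqrt (r\<^sup>2 - s\<^sup>2))) = 0"
    and s0: "0 < s0" "s0 \<le> R" and van: "\<And>r. s0 < r \<Longrightarrow> r \<le> R \<Longrightarrow> d r = 0"
  shows "\<exists>s1. 0 < s1 \<and> s1 < s0 \<and> (\<forall>r\<in>{s1..s0}. d r = 0)"
proof -
  define H where "H = (\<lambda>v. d (sqrt (s0\<^sup>2 - v)))"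
  define k where "k = (\<lambda>u v. kernel_K R \<mu> n (sqrt (s0\<^sup>2 - u)) (sqrt (s0\<^sup>2 - v)))"
  have le_s0: "sqrt (s0\<^sup>2 - v) \<le> s0" if "0 \<le> v" for v
  proof -
    have "sqrt (s0\<^sup>2 - v) \<le> sqrt (s0\<^sup>2)" using that by (intro real_sqrt_le_mono) auto
    then show ?thesis using s0 by simp
  qed
  have le_R: "sqrt (s0\<^sup>2 - v) \<le> R" if "0 \<le> v" for v using le_s0[OF that] s0 by linarith
  have contH: "continuous_on {0..a} H" if "a < s0\<^sup>2" for a
    unfolding H_def
    by (intro continuous_on_compose2[OF cont] continuous_intros) (use that le_R in auto)
  have contk: "continuous_on {(v, u). 0 \<le> v \<and> v \<le> u \<and> u \<le> a} (\<lambda>(v, u). k u v)" if "a < s0\<^sup>2" for a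
  proof -
    have "continuous_on {(v, u). 0 \<le> v \<and> v \<le> u \<and> u \<le> a}
        (\<lambda>z. (\<lambda>(s,r). kernel_K R \<mu> n s r) (sqrt (s0\<^sup>2 - snd z), sqrt (s0\<^sup>2 - fst z)))"
      by (intro continuous_on_compose2[OF continuous_on_kernel_K] continuous_intros) (use that le_R in auto)
    then show ?thesis by (simp add: case_prod_unfold k_def)
  qed
  have abel: "(LBINT v:{0..u}. H v * k u v / sqrt (u - v)) = 0" if u: "0 < u" "u < s0\<^sup>2" for u
  proof -
    define s where "s = sqrt (s0\<^sup>2 - u)"
    have s: "0 < s" "s\<^sup>2 = s0\<^sup>2 - u" "s \<le> s0" using u le_s0[of u] by (auto simp: s_def)
    have "s < s0" using s u s0 by (metis diff_add_cancel less_add_same_cancel1 order_le_less less_irrefl)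
    define q where "q = (\<lambda>w. d (sqrt w) * kernel_K R \<mu> n s (sqrt w) / 2)"
    have rt: "s \<le> sqrt w \<and> sqrt w \<le> R" if "s\<^sup>2 \<le> w" "w \<le> s0\<^sup>2" for w
    proof
      show "s \<le> sqrt w" using that by (intro real_le_rsqrt)
      have "sqrt w \<le> sqrt (s0\<^sup>2)" using that by (intro real_sqrt_le_mono)
      then show "sqrt w \<le> R" using s0 by simp
    qed
    have rt': "0 \<le> w \<and> sqrt w \<le> R" if "s\<^sup>2 \<le> w" "w \<le> s0\<^sup>2" for w
      using rt[OF that] that zero_le_power2[of s] by linarith
    have contq: "continuous_on {s\<^sup>2..s0\<^sup>2} q"
    proof -
      have "continuous_on {s\<^sup>2..s0\<^sup>2} (\<lambda>w. (\<lambda>(s,r). kernel_K R \<mu> n s r) (s, sqrt w))"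
        by (intro continuous_on_compose2[OF continuous_on_kernel_K] continuous_intros) (use s rt in auto)
      moreover have "continuous_on {s\<^sup>2..s0\<^sup>2} (\<lambda>w. d (sqrt w))"
        by (intro continuous_on_compose2[OF cont] continuous_intros) (use rt' in auto)
      ultimately show ?thesis unfolding q_def by (auto intro!: continuous_intros)
    qed
    have "0 = (LBINT r:{s..R}. d r * (r * kernel_K R \<mu> n s r / sqrt (r\<^sup>2 - s\<^sup>2)))"
      using eq[of s] s s0 \<open>s < s0\<close> by simp
    also have "\<dots> = (LBINT r:{s..s0}. q (r\<^sup>2) / sqrt (r\<^sup>2 - s\<^sup>2) * (2 * r))"
      unfolding set_lebesgue_integral_def
    proof (rule Bochner_Integration.integral_cong)
      fix r
      show "indicator {s..R} r *\<^sub>R (d r * (r * kernel_K R \<mu> n s r / sqrt (r\<^sup>2 - s\<^sup>2)))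
          = indicator {s..s0} r *\<^sub>R (q (r\<^sup>2) / sqrt (r\<^sup>2 - s\<^sup>2) * (2 * r))"
        using van[of r] s s0 by (auto simp: q_def split: split_indicator)
    qed simp
    also have "\<dots> = (LBINT w:{s\<^sup>2..s0\<^sup>2}. q w / sqrt (w - s\<^sup>2))"
      using weakly_singular_integral_radius[OF s(1,3) contq] by simp
    also have "{s\<^sup>2..s0\<^sup>2} = {s0\<^sup>2 - u..s0\<^sup>2 - 0}" using s by simp
    also have "(LBINT w:{s0\<^sup>2 - u..s0\<^sup>2 - 0}. q w / sqrt (w - s\<^sup>2)) = (LBINT v:{0..u}. q (s0\<^sup>2 - v) / sqrt (s0\<^sup>2 - v - s\<^sup>2))"
      by (rule set_integral_reflect)
    also have "\<dots> = (LBINT v:{0..u}. (1 / 2) * (H v * k u v / sqrt (u - v)))"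
      unfolding s(2) by (simp add: q_def H_def k_def s_def)
    also have "\<dots> = (1 / 2) * (LBINT v:{0..u}. H v * k u v / sqrt (u - v))"
      by (rule set_integral_mult_right)
    finally show ?thesis by simp
  qed
  have "\<exists>a>0. a < s0\<^sup>2 \<and> (\<forall>v\<in>{0..a}. H v = 0)"
  proof (cases "cos (of_int n * arccos (s0 / R)) = 0")
    case False
    obtain L a0 where a0: "a0 > 0" and L: "\<And>v u u'. 0 \<le> v \<Longrightarrow> v \<le> u \<Longrightarrow> u \<le> u' \<Longrightarrow> u' \<le> a0 \<Longrightarrow>
        \<bar>k u' v - k u v\<bar> \<le> L * (u' - u)"
      using kernel_lipschitz[OF s0, of \<mu> n] unfolding k_def by metis
    define a where "a = min a0 (s0\<^sup>2 / 2)"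
    have a: "0 < a" "a \<le> a0" "a < s0\<^sup>2" using a0 s0 by (auto simp: a_def min_def)
    have "k 0 0 \<noteq> 0" using False s0 by (simp add: k_def kernel_K_diagonal)
    then have "\<exists>\<delta>>0. \<delta> \<le> a \<and> (\<forall>v\<in>{0..\<delta>}. H v = 0)"
      by (intro regular_abel_equation_local_uniqueness[where k = k and L = L] contH contk abel L) (use a in auto)
    then show ?thesis using a by (meson le_less_trans)
  next
    case True
    \<comment> \<open>At the rim the diagonal value is \<open>2 cos 0 = 2\<close>.\<close>
    have "s0 < R"
    proof (rule ccontr)
      assume "\<not> s0 < R"
      then have "s0 / R = 1" using s0 by simp
      then show False using True by simp
    qed
    have n0: "n \<noteq> 0" using True by auto
    define \<sigma> where "\<sigma> = sin (of_int n * arccos (s0 / R))"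
    have \<sigma>: "\<sigma> \<noteq> 0" using True sin_cos_squared_add[of "of_int n * arccos (s0 / R)"] by (auto simp: \<sigma>_def)
    define w where "w = sqrt (R\<^sup>2 - s0\<^sup>2)"
    have sq: "s0\<^sup>2 < R\<^sup>2" using \<open>s0 < R\<close> s0 by (simp add: power_strict_mono)
    have w: "0 < w" using sq by (simp add: w_def)
    have "w < sqrt (R\<^sup>2)" unfolding w_def using s0 by (intro real_sqrt_less_mono) simp
    then have wR: "w < R" using R by simp
    have \<mu>w: "\<mu> * w < 3 / 2"
    proof (cases "\<mu> \<le> 0")
      case True
      then have "\<mu> * w \<le> 0" using w by (simp add: mult_nonpos_nonneg)
      then show ?thesis by simp
    next
      case False
      then have "\<mu> * w < \<mu> * R" using wR by simp
      then show ?thesis using \<mu> by simp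
    qed
    define a where "a = s0\<^sup>2 / 2"
    have a: "0 < a" "a < s0\<^sup>2" using s0 by (auto simp: a_def)
    have "\<exists>\<delta>>0. \<delta> \<le> a \<and> (\<forall>v\<in>{0..\<delta>}. H v = 0)"
    proof (rule degenerate_abel_equation_local_uniqueness[where k = k
          and \<kappa> = "of_int n * \<sigma> / s0 * (2 * \<mu> - 1 / w)" and c = "- (of_int n * \<sigma> / (s0 * w))"])
      show "k 0 0 = 0" using True s0 by (simp add: k_def kernel_K_diagonal)
      show "((\<lambda>x. k x x) has_real_derivative - (of_int n * \<sigma> / (s0 * w))) (at 0 within {0..a})"
        using kernel_diagonal_derivative[OF s0 \<open>s0 < R\<close> a, of \<mu> n] by (simp add: k_def w_def \<sigma>_def)
      show "\<exists>\<delta>>0. \<forall>v u u'. 0 \<le> v \<longrightarrow> v \<le> u \<longrightarrow> u \<le> u' \<longrightarrow> u' \<le> \<delta> \<longrightarrow>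
        \<bar>k u' v - k u v - of_int n * \<sigma> / s0 * (2 * \<mu> - 1 / w) * (u' - u)\<bar> \<le> \<epsilon> * (u' - u)" if "0 < \<epsilon>" for \<epsilon>
        using kernel_strict_derivative_at_zero[OF s0 \<open>s0 < R\<close> True that, of \<mu>]
        unfolding k_def w_def \<sigma>_def .
      show "- (of_int n * \<sigma> / (s0 * w)) \<noteq> 0" using n0 \<sigma> s0 w by simp
      have "of_int n * \<sigma> / s0 * (2 * \<mu> - 1 / w) / (2 * - (of_int n * \<sigma> / (s0 * w))) = (1 - 2 * (\<mu> * w)) / 2"
        using n0 \<sigma> s0 w by (simp add: field_simps)
      then show "-1 < of_int n * \<sigma> / s0 * (2 * \<mu> - 1 / w) / (2 * - (of_int n * \<sigma> / (s0 * w)))"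
        using \<mu>w by simp
    qed (use a contH contk abel in auto)
    then show ?thesis using a by (meson le_less_trans)
  qed
  then obtain a where a: "0 < a" "a < s0\<^sup>2" "\<And>v. v \<in> {0..a} \<Longrightarrow> H v = 0" by blast
  have "d r = 0" if "r \<in> {sqrt (s0\<^sup>2 - a)..s0}" for r
  proof -
    have "0 \<le> sqrt (s0\<^sup>2 - a)" using a by simp
    moreover have le: "sqrt (s0\<^sup>2 - a) \<le> r" "r \<le> s0" using that by auto
    ultimately have r: "0 \<le> r" "sqrt (s0\<^sup>2 - a) \<le> r" "r \<le> s0" by linarith+
    then have "s0\<^sup>2 - a \<le> r\<^sup>2" "r\<^sup>2 \<le> s0\<^sup>2" using a by (auto simp: sqrt_le_D intro: power_mono)
    then show ?thesis using a(3)[of "s0\<^sup>2 - r\<^sup>2"] r by (simp add: H_def)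
  qed
  moreover have "sqrt (s0\<^sup>2 - a) < s0"
  proof -
    have "sqrt (s0\<^sup>2 - a) < sqrt (s0\<^sup>2)" using a by (intro real_sqrt_less_mono) simp
    then show ?thesis using s0 by simp
  qed
  moreover have "0 < sqrt (s0\<^sup>2 - a)" using a by simp
  ultimately show ?thesis by blast
qed

text \<open>
  The supremum of the points where \<open>d\<close> does not vanish could be lowered by the local result.
\<close>
lemma homogeneous_equation_uniqueness:
  fixes d :: "real \<Rightarrow> real"
  assumes R: "0 < R" and \<mu>: "\<mu> * R \<le> 3 / 2"
    and cont: "continuous_on {0..R} d"
    and eq: "\<And>s. 0 < s \<Longrightarrow> s < R \<Longrightarrow> (LBINT r:{s..R}. d r * (r * kernel_K R \<mu> n s r / sqrt (r\<^sup>2 - s\<^sup>2))) = 0"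
    and r: "r \<in> {0..R}"
  shows "d r = 0"
proof -
  \<comment> \<open>The origin is left out of \<open>N\<close>: the local result applies at positive radii only, and \<open>d 0\<close> follows by continuity.\<close>
  define N where "N = {r\<in>{0<..R}. d r \<noteq> 0}"
  have "N = {}"
  proof (rule ccontr)
    assume ne: "N \<noteq> {}"
    have bdd: "bdd_above N" by (rule bdd_aboveI[of _ R]) (auto simp: N_def)
    obtain r0 where r0: "r0 \<in> N" using ne by blast
    have s0: "0 < Sup N" "Sup N \<le> R"
    proof -
      have "0 < r0" using r0 by (simp add: N_def)
      also have "r0 \<le> Sup N" using r0 bdd by (rule cSup_upper)
      finally show "0 < Sup N" .
      show "Sup N \<le> R" using ne by (rule cSup_least) (auto simp: N_def)
    qed
    have "d r = 0" if "Sup N < r" "r \<le> R" for r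
      using that s0 cSup_upper[OF _ bdd, of r] by (force simp: N_def)
    from homogeneous_equation_local_uniqueness[OF R \<mu> cont eq s0 this]
    obtain s1 where s1: "s1 < Sup N" "\<And>r. r \<in> {s1..Sup N} \<Longrightarrow> d r = 0" by blast
    obtain r1 where "r1 \<in> N" "s1 < r1" using less_cSupD[OF ne s1(1)] by blast
    then show False using s1(2)[of r1] cSup_upper[OF _ bdd, of r1] by (auto simp: N_def)
  qed
  then have z: "d x = 0" if "x \<in> {0<..R}" for x using that by (auto simp: N_def)
  show ?thesis
    by (rule continuous_constant_on_closure[where S = "{0<..R}"])
       (use z r R cont in \<open>auto simp: closure_greaterThanAtMost\<close>)
qed

section \<open>Fourier coefficients of the transform\<close>

lemma Cc_inf_disc_continuous: "f \<in> Cc_inf_disc R \<Longrightarrow> continuous_on UNIV f"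
  unfolding Cc_inf_disc_def smooth_def using C_k.simps(1) by blast

lemma Cc_inf_disc_vanishes: "f \<in> Cc_inf_disc R \<Longrightarrow> R \<le> norm x \<Longrightarrow> f x = 0"
  unfolding Cc_inf_disc_def using closure_subset[of "{x. f x \<noteq> 0}"] by (auto simp: subset_iff)

lemma unit_dir_eq: "unit_dir \<phi> = cos \<phi> *\<^sub>R axis 1 1 + sin \<phi> *\<^sub>R axis 2 1"
  by (simp add: unit_dir_def vec_eq_iff forall_2 axis_def)

lemma continuous_on_unit_dir [continuous_intros]:
  fixes g :: "'a::t2_space \<Rightarrow> real"
  shows "continuous_on S g \<Longrightarrow> continuous_on S (\<lambda>x. unit_dir (g x))"
  unfolding unit_dir_eq by (intro continuous_intros)

lemma norm_unit_dir: "norm (unit_dir \<phi>) = 1"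
  by (simp add: unit_dir_def norm_vec_def L2_set_def sum_2)

lemma unit_dir_periodic: "unit_dir (\<phi> + 2 * pi) = unit_dir \<phi>"
  by (simp add: unit_dir_def)

text \<open>
  The foot of the perpendicular from the origin to the chord lies at distance \<open>R cos \<psi>\<close> from
  the vertex \<open>R \<Phi>(\<phi>)\<close>, and \<open>\<tau>\<close> is the signed distance from it, counted towards the vertex.
\<close>
lemma chord_point_polar:
  assumes s: "0 < s" and sR: "s = R * sin \<psi>" and \<sigma>: "\<sigma> \<in> {1, - 1::real}"
  shows "R *\<^sub>R unit_dir \<phi> - (R * cos \<psi> - \<tau>) *\<^sub>R unit_dir (\<phi> - \<sigma> * \<psi>)
    = sqrt (s\<^sup>2 + \<tau>\<^sup>2) *\<^sub>R unit_dir (\<phi> + \<sigma> * (pi / 2 - \<psi> - arctan (\<tau> / s)))"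
proof -
  define r \<theta> where "r = sqrt (s\<^sup>2 + \<tau>\<^sup>2)" and "\<theta> = arctan (\<tau> / s)"
  have "sqrt (1 + (\<tau> / s)\<^sup>2) = r / s"
  proof -
    have "1 + (\<tau> / s)\<^sup>2 = (s\<^sup>2 + \<tau>\<^sup>2) / s\<^sup>2" using s by (simp add: power_divide add_divide_distrib)
    then show ?thesis using s by (simp add: r_def real_sqrt_divide)
  qed
  moreover have "r > 0" using s by (auto simp: r_def intro: add_pos_nonneg)
  ultimately have rt: "r * cos \<theta> = s" "r * sin \<theta> = \<tau>"
    using s by (auto simp: \<theta>_def cos_arctan sin_arctan)
  have rc: "r * cos (pi / 2 - \<psi> - \<theta>) = sin \<psi> * s + cos \<psi> * \<tau>"
    "r * sin (pi / 2 - \<psi> - \<theta>) = cos \<psi> * s - sin \<psi> * \<tau>"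
  proof -
    have e: "pi / 2 - \<psi> - \<theta> = pi / 2 - (\<psi> + \<theta>)" by simp
    have c: "cos (pi / 2 - \<psi> - \<theta>) = sin \<psi> * cos \<theta> + cos \<psi> * sin \<theta>"
      and d: "sin (pi / 2 - \<psi> - \<theta>) = cos \<psi> * cos \<theta> - sin \<psi> * sin \<theta>"
      unfolding e by (simp_all add: cos_diff sin_diff sin_add cos_add)
    show "r * cos (pi / 2 - \<psi> - \<theta>) = sin \<psi> * s + cos \<psi> * \<tau>"
      "r * sin (pi / 2 - \<psi> - \<theta>) = cos \<psi> * s - sin \<psi> * \<tau>"
      unfolding c d rt[symmetric] by (simp_all add: algebra_simps)
  qed
  have \<sigma>cs: "cos (\<sigma> * x) = cos x" "sin (\<sigma> * x) = \<sigma> * sin x" for x using \<sigma> by auto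
  have p: "(cos \<psi>)\<^sup>2 = 1 - (sin \<psi>)\<^sup>2" by (rule cos_squared_eq)
  have "R * cos \<phi> - (R * cos \<psi> - \<tau>) * cos (\<phi> - \<sigma> * \<psi>)
      = cos \<phi> * (R * (1 - (cos \<psi>)\<^sup>2) + \<tau> * cos \<psi>) - \<sigma> * sin \<phi> * (cos \<psi> * (R * sin \<psi>) - sin \<psi> * \<tau>)"
    unfolding cos_diff \<sigma>cs by (simp add: algebra_simps power2_eq_square)
  also have "\<dots> = cos \<phi> * (r * cos (pi / 2 - \<psi> - \<theta>)) - \<sigma> * sin \<phi> * (r * sin (pi / 2 - \<psi> - \<theta>))"
    unfolding rc sR p by (simp add: algebra_simps power2_eq_square)
  also have "\<dots> = r * cos (\<phi> + \<sigma> * (pi / 2 - \<psi> - \<theta>))"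
    unfolding cos_add \<sigma>cs by (simp add: algebra_simps)
  finally have 1: "R * cos \<phi> - (R * cos \<psi> - \<tau>) * cos (\<phi> - \<sigma> * \<psi>) = r * cos (\<phi> + \<sigma> * (pi / 2 - \<psi> - \<theta>))" .
  have "R * sin \<phi> - (R * cos \<psi> - \<tau>) * sin (\<phi> - \<sigma> * \<psi>)
      = sin \<phi> * (R * (1 - (cos \<psi>)\<^sup>2) + \<tau> * cos \<psi>) + \<sigma> * cos \<phi> * (cos \<psi> * (R * sin \<psi>) - sin \<psi> * \<tau>)"
    unfolding sin_diff \<sigma>cs by (simp add: algebra_simps power2_eq_square)
  also have "\<dots> = sin \<phi> * (r * cos (pi / 2 - \<psi> - \<theta>)) + \<sigma> * cos \<phi> * (r * sin (pi / 2 - \<psi> - \<theta>))"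
    unfolding rc sR p by (simp add: algebra_simps power2_eq_square)
  also have "\<dots> = r * sin (\<phi> + \<sigma> * (pi / 2 - \<psi> - \<theta>))"
    unfolding sin_add \<sigma>cs by (simp add: algebra_simps)
  finally have 2: "R * sin \<phi> - (R * cos \<psi> - \<tau>) * sin (\<phi> - \<sigma> * \<psi>) = r * sin (\<phi> + \<sigma> * (pi / 2 - \<psi> - \<theta>))" .
  show ?thesis
    using 1 2 by (simp add: unit_dir_def vec_eq_iff forall_2 r_def \<theta>_def)
qed

lemma integral_periodic_shift:
  fixes w :: "real \<Rightarrow> complex"
  assumes cont: "continuous_on UNIV w" and per: "\<And>x. w (x + P) = w x" and P: "0 \<le> P"
  shows "integral {0..P} (\<lambda>x. w (x + a)) = integral {0..P} w"
proof -
  have i: "w integrable_on {x..y}" for x y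
    by (rule integrable_continuous_interval[OF continuous_on_subset[OF cont]]) simp
  have sh: "integral {x + c..y + c} w = integral {x..y} (\<lambda>x. w (x + c))" for x y c
    using integral_shift_real_ivl[of "x + c" c "y + c" w] by simp
  have shP: "integral {x + P..y + P} w = integral {x..y} w" for x y
    unfolding sh by (simp add: per)
  have "integral {0..P} (\<lambda>x. w (x + a)) = integral {a..P + a} w" using sh[of 0 a P] by simp
  also have "\<dots> = integral {0..P} w"
  proof (cases "0 \<le> a")
    case True
    have "integral {0..a} w + integral {a..P + a} w = integral {0..P} w + integral {P..P + a} w"
      using True P i by (simp add: Henstock_Kurzweil_Integration.integral_combine)
    moreover have "integral {P..P + a} w = integral {0..a} w" using shP[of 0 a] by (simp add: add.commute)
    ultimately show ?thesis by simp
  next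
    case False
    have "integral {a..P + a} w + integral {P + a..P} w = integral {a..0} w + integral {0..P} w"
      using False P i by (simp add: Henstock_Kurzweil_Integration.integral_combine)
    moreover have "integral {P + a..P} w = integral {a..0} w" using shP[of a 0] by (simp add: add.commute)
    ultimately show ?thesis by simp
  qed
  finally show ?thesis .
qed

lemma fourier_coeff_eq_integral:
  assumes "continuous_on {0..2 * pi} u"
  shows "fourier_coeff n u = 1 / (2 * pi) *
    integral {0..2 * pi} (\<lambda>\<phi>. complex_of_real (u \<phi>) * exp (- \<i> * of_int n * complex_of_real \<phi>))"
  unfolding fourier_coeff_def using assms
  by (subst set_borel_integral_eq_integral)
     (auto intro!: borel_integrable_atLeastAtMost' continuous_intros)

lemma fourier_coeff_rotate:
  assumes cont: "continuous_on UNIV u" and per: "\<And>x. u (x + 2 * pi) = u x"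
  shows "fourier_coeff n (\<lambda>\<phi>. u (\<phi> + a)) = exp (\<i> * of_int n * complex_of_real a) * fourier_coeff n u"
proof -
  define w where "w = (\<lambda>\<phi>. complex_of_real (u \<phi>) * exp (- \<i> * of_int n * complex_of_real \<phi>))"
  have cw: "continuous_on UNIV w" unfolding w_def by (intro continuous_intros cont)
  have "w (x + 2 * pi) = w x" for x
  proof -
    have "exp (- (\<i> * of_int n * (complex_of_real x + 2 * complex_of_real pi))) =
        exp (- (\<i> * of_int n * complex_of_real x)) * exp ((2 * of_int (- n) * pi) * \<i>)"
      by (simp flip: exp_add add: algebra_simps)
    also have "exp ((2 * of_int (- n) * pi) * \<i>) = 1"
      by (metis Ints_of_int exp_integer_2pi)
    finally show ?thesis by (simp add: w_def per)
  qed
  then have "integral {0..2 * pi} (\<lambda>x. w (x + a)) = integral {0..2 * pi} w"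
    by (intro integral_periodic_shift[OF cw]) auto
  moreover have "(\<lambda>\<phi>. complex_of_real (u (\<phi> + a)) * exp (- \<i> * of_int n * complex_of_real \<phi>))
      = (\<lambda>\<phi>. exp (\<i> * of_int n * complex_of_real a) * w (\<phi> + a))"
    by (rule ext) (simp add: w_def exp_add[symmetric] algebra_simps flip: exp_add)
  moreover have "continuous_on {0..2 * pi} (\<lambda>\<phi>. u (\<phi> + a))"
    by (intro continuous_on_compose2[OF cont] continuous_intros) auto
  ultimately show ?thesis
    using continuous_on_subset[OF cont, of "{0..2 * pi}"]
    by (simp add: fourier_coeff_eq_integral w_def)
qed

lemma f_coeff_eq_integral:
  assumes "continuous_on UNIV f"
  shows "f_coeff f n r = 1 / (2 * pi) *
    integral {0..2 * pi} (\<lambda>\<phi>. complex_of_real (f (r *\<^sub>R unit_dir \<phi>)) * exp (- \<i> * of_int n * complex_of_real \<phi>))"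
  unfolding f_coeff_def
  by (rule fourier_coeff_eq_integral) (intro continuous_on_compose2[OF assms] continuous_intros; simp)

lemma continuous_on_f_coeff:
  assumes "continuous_on UNIV f"
  shows "continuous_on S (f_coeff f n)"
proof -
  have "continuous_on (S \<times> cbox 0 (2 * pi)) (\<lambda>z. complex_of_real (f (fst z *\<^sub>R unit_dir (snd z))) * exp (- \<i> * of_int n * complex_of_real (snd z)))"
    by (intro continuous_intros continuous_on_compose2[OF assms]) auto
  then have "continuous_on S (\<lambda>r. integral (cbox 0 (2 * pi)) (\<lambda>\<phi>. complex_of_real (f (r *\<^sub>R unit_dir \<phi>)) * exp (- \<i> * of_int n * complex_of_real \<phi>)))"
    by (intro integral_continuous_on_param) (simp add: case_prod_unfold)
  then show ?thesis
    unfolding f_coeff_eq_integral[OF assms, abs_def] by (auto intro!: continuous_intros)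
qed

lemma f_coeff_rotate:
  assumes "continuous_on UNIV f"
  shows "fourier_coeff n (\<lambda>\<phi>. f (r *\<^sub>R unit_dir (\<phi> + a))) = exp (\<i> * of_int n * complex_of_real a) * f_coeff f n r"
  unfolding f_coeff_def
  by (rule fourier_coeff_rotate[where u = "\<lambda>\<phi>. f (r *\<^sub>R unit_dir \<phi>)"])
     (auto intro!: continuous_on_compose2[OF assms] continuous_intros simp: unit_dir_periodic)

lemma fourier_coeff_mult_right: "fourier_coeff n (\<lambda>\<phi>. u \<phi> * c) = of_real c * fourier_coeff n u"
proof -
  have "fourier_coeff n (\<lambda>\<phi>. u \<phi> * c) = 1 / (2 * pi) *
     (LBINT \<phi>:{0..2 * pi}. of_real c * (complex_of_real (u \<phi>) * exp (- \<i> * of_int n * complex_of_real \<phi>)))"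
    unfolding fourier_coeff_def by (simp add: mult_ac)
  then show ?thesis unfolding set_integral_mult_right by (simp add: fourier_coeff_def)
qed

lemma fourier_coeff_add:
  assumes "continuous_on {0..2 * pi} u" "continuous_on {0..2 * pi} v"
  shows "fourier_coeff n (\<lambda>\<phi>. u \<phi> + v \<phi>) = fourier_coeff n u + fourier_coeff n v"
proof -
  have "continuous_on {0..2 * pi} (\<lambda>\<phi>. u \<phi> + v \<phi>)" by (intro continuous_intros assms)
  then show ?thesis using assms
    by (simp add: fourier_coeff_eq_integral distrib_right integral_add integrable_continuous_interval
          continuous_intros distrib_left)
qed

lemma fourier_coeff_integral:
  fixes p :: "real \<Rightarrow> real \<Rightarrow> real"
  assumes "continuous_on UNIV (\<lambda>(\<phi>, \<rho>). p \<phi> \<rho>)"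
  shows "fourier_coeff n (\<lambda>\<phi>. integral {a..b} (p \<phi>)) = integral {a..b} (\<lambda>\<rho>. fourier_coeff n (\<lambda>\<phi>. p \<phi> \<rho>))"
proof -
  define e where "e = (\<lambda>\<phi>. exp (- \<i> * of_int n * complex_of_real \<phi>))"
  have c: "continuous_on S (\<lambda>z. p (fst z) (snd z))" for S
    using continuous_on_subset[OF assms, of S] by (simp add: case_prod_unfold)
  have c1: "continuous_on S (\<lambda>\<rho>. p \<phi> \<rho>)" for S \<phi>
    using continuous_on_compose2[OF c[of UNIV], of S "\<lambda>\<rho>. (\<phi>, \<rho>)"] by (simp add: continuous_intros)
  have c2: "continuous_on S (\<lambda>\<phi>. p \<phi> \<rho>)" for S \<rho>
    using continuous_on_compose2[OF c[of UNIV], of S "\<lambda>\<phi>. (\<phi>, \<rho>)"] by (simp add: continuous_intros)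
  have ci: "continuous_on {0..2 * pi} (\<lambda>\<phi>. integral {a..b} (p \<phi>))"
    using integral_continuous_on_param[of "{0..2 * pi}" a b p] c by (simp add: case_prod_unfold)
  have "fourier_coeff n (\<lambda>\<phi>. integral {a..b} (p \<phi>))
      = 1 / (2 * pi) * integral {0..2 * pi} (\<lambda>\<phi>. complex_of_real (integral {a..b} (p \<phi>)) * e \<phi>)"
    unfolding e_def by (rule fourier_coeff_eq_integral[OF ci])
  also have "(\<lambda>\<phi>. complex_of_real (integral {a..b} (p \<phi>)) * e \<phi>)
      = (\<lambda>\<phi>. integral {a..b} (\<lambda>\<rho>. complex_of_real (p \<phi> \<rho>) * e \<phi>))"
  proof
    fix \<phi>
    have "integral {a..b} (complex_of_real \<circ> p \<phi>) = complex_of_real (integral {a..b} (p \<phi>))"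
      by (rule integral_linear[OF integrable_continuous_interval[OF c1] bounded_linear_of_real])
    then show "complex_of_real (integral {a..b} (p \<phi>)) * e \<phi> = integral {a..b} (\<lambda>\<rho>. complex_of_real (p \<phi> \<rho>) * e \<phi>)"
      by (simp add: o_def)
  qed
  also have "integral {0..2 * pi} \<dots> = integral {a..b} (\<lambda>\<rho>. integral {0..2 * pi} (\<lambda>\<phi>. complex_of_real (p \<phi> \<rho>) * e \<phi>))"
  proof -
    have "continuous_on (cbox (0, a) (2 * pi, b)) (\<lambda>(\<phi>, \<rho>). complex_of_real (p \<phi> \<rho>) * e \<phi>)"
      unfolding case_prod_unfold e_def by (intro continuous_intros c)
    from integral_swap_continuous[OF this] show ?thesis by simp
  qed
  also have "1 / (2 * pi) * \<dots> = integral {a..b} (\<lambda>\<rho>. 1 / (2 * pi) * integral {0..2 * pi} (\<lambda>\<phi>. complex_of_real (p \<phi> \<rho>) * e \<phi>))"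
    by simp
  also have "(\<lambda>\<rho>. 1 / (2 * pi) * integral {0..2 * pi} (\<lambda>\<phi>. complex_of_real (p \<phi> \<rho>) * e \<phi>)) = (\<lambda>\<rho>. fourier_coeff n (\<lambda>\<phi>. p \<phi> \<rho>))"
    unfolding e_def by (rule ext) (rule fourier_coeff_eq_integral[OF c2, symmetric])
  finally show ?thesis .
qed

text \<open>
  Each branch contributes \<open>exp (i n \<sigma> \<alpha>(\<tau>))\<close>, and the two branches add up to \<open>2 cos (n \<alpha>(\<tau>))\<close>.  The branch
  lies in the disc for \<open>- b < \<tau> < b\<close>; folding this interval at \<open>0\<close> produces \<open>F(t) + F(- t)\<close>,
  which is the kernel.
\<close>
lemma g_coeff_chord_integral:
  assumes R: "0 < R" and f: "f \<in> Cc_inf_disc R" and \<psi>: "\<psi> \<in> {0<..<pi / 2}"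
  defines "s \<equiv> R * sin \<psi>" and "b \<equiv> R * cos \<psi>"
  shows "g_coeff R \<mu> f n \<psi> = 2 * complex_of_real (exp (- \<mu> * b)) *
     integral {0..b} (\<lambda>t. f_coeff f n (sqrt (s\<^sup>2 + t\<^sup>2)) * complex_of_real (kernel_K R \<mu> n s (sqrt (s\<^sup>2 + t\<^sup>2))))"
proof -
  have cf: "continuous_on UNIV f" using f by (rule Cc_inf_disc_continuous)
  have "0 < sin \<psi>" "0 < cos \<psi>" using \<psi> by (auto intro: sin_gt_zero cos_gt_zero)
  then have s: "0 < s" and b: "0 < b" using R by (auto simp: s_def b_def)
  have sb: "s\<^sup>2 + b\<^sup>2 = R\<^sup>2"
    by (simp add: s_def b_def power_mult_distrib flip: distrib_left)
  define \<alpha> where "\<alpha> = (\<lambda>\<tau>. pi / 2 - \<psi> - arctan (\<tau> / s))"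
  define p where "p = (\<lambda>\<sigma> \<phi> \<rho>. f (R *\<^sub>R unit_dir \<phi> - \<rho> *\<^sub>R unit_dir (\<phi> - \<sigma> * \<psi>)) * exp (- \<mu> * \<rho>))"
  have polar: "p \<sigma> \<phi> \<rho> = f (sqrt (s\<^sup>2 + (b - \<rho>)\<^sup>2) *\<^sub>R unit_dir (\<phi> + \<sigma> * \<alpha> (b - \<rho>))) * exp (- \<mu> * \<rho>)"
    if "\<sigma> \<in> {1, - 1}" for \<sigma> \<phi> \<rho>
    using chord_point_polar[OF s s_def[THEN meta_eq_to_obj_eq] that, of \<phi> "b - \<rho>"]
    by (simp add: p_def \<alpha>_def b_def)
  have contp: "continuous_on UNIV (\<lambda>(\<phi>, \<rho>). p \<sigma> \<phi> \<rho>)" for \<sigma>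
    unfolding case_prod_unfold p_def
    by (intro continuous_intros continuous_on_compose2[OF cf]) auto
  have contp1: "continuous_on S (p \<sigma> \<phi>)" for S \<sigma> \<phi>
    unfolding p_def by (intro continuous_intros continuous_on_compose2[OF cf]) auto
  \<comment> \<open>Beyond \<open>\<rho> = 2 b\<close> the branch has left the disc.\<close>
  have vl: "(LBINT \<rho>:{0..}. p \<sigma> \<phi> \<rho>) = integral {0..2 * b} (p \<sigma> \<phi>)" if \<sigma>: "\<sigma> \<in> {1, - 1}" for \<sigma> \<phi>
  proof -
    have "p \<sigma> \<phi> \<rho> = 0" if "2 * b < \<rho>" for \<rho>
    proof -
      have "b\<^sup>2 \<le> (\<rho> - b)\<^sup>2" using that b by (intro power_mono) auto
      then have "R\<^sup>2 \<le> s\<^sup>2 + (b - \<rho>)\<^sup>2" by (simp add: power2_commute flip: sb)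
      then have "R \<le> sqrt (s\<^sup>2 + (b - \<rho>)\<^sup>2)" by (rule real_le_rsqrt)
      then show ?thesis
        unfolding polar[OF \<sigma>] by (subst Cc_inf_disc_vanishes[OF f]) (auto simp: norm_unit_dir)
    qed
    then have "(LBINT \<rho>:{0..}. p \<sigma> \<phi> \<rho>) = (LBINT \<rho>:{0..2 * b}. p \<sigma> \<phi> \<rho>)"
      unfolding set_lebesgue_integral_def
      by (intro Bochner_Integration.integral_cong refl) (auto split: split_indicator)
    also have "\<dots> = integral {0..2 * b} (p \<sigma> \<phi>)"
      by (intro set_borel_integral_eq_integral borel_integrable_atLeastAtMost' contp1)
    finally show ?thesis .
  qed
  have coeff: "fourier_coeff n (\<lambda>\<phi>. p \<sigma> \<phi> \<rho>) = of_real (exp (- \<mu> * \<rho>)) *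
      (exp (\<i> * of_int n * complex_of_real (\<sigma> * \<alpha> (b - \<rho>))) * f_coeff f n (sqrt (s\<^sup>2 + (b - \<rho>)\<^sup>2)))"
    if \<sigma>: "\<sigma> \<in> {1, - 1}" for \<sigma> \<rho>
    unfolding polar[OF \<sigma>] fourier_coeff_mult_right f_coeff_rotate[OF cf] ..
  define Y where "Y = (\<lambda>\<tau>. of_real (exp (- \<mu> * (b - \<tau>)) * (2 * cos (of_int n * \<alpha> \<tau>))) * f_coeff f n (sqrt (s\<^sup>2 + \<tau>\<^sup>2)))"
  have contY: "continuous_on S Y" for S
  proof -
    have "continuous_on S (\<lambda>\<tau>. f_coeff f n (sqrt (s\<^sup>2 + \<tau>\<^sup>2)))"
      by (intro continuous_on_compose2[OF continuous_on_f_coeff[OF cf, of UNIV]] continuous_intros) auto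
    then show ?thesis
      unfolding Y_def \<alpha>_def using s by (intro continuous_intros) auto
  qed
  have ci: "continuous_on {0..2 * pi} (\<lambda>\<phi>. integral {0..2 * b} (p \<sigma> \<phi>))" for \<sigma>
    using integral_continuous_on_param[of "{0..2 * pi}" 0 "2 * b" "p \<sigma>"] continuous_on_subset[OF contp[of \<sigma>]]
    by simp
  have cc: "continuous_on {0..2 * b} (\<lambda>\<rho>. fourier_coeff n (\<lambda>\<phi>. p \<sigma> \<phi> \<rho>))" if \<sigma>: "\<sigma> \<in> {1, - 1}" for \<sigma>
  proof -
    have "continuous_on {0..2 * b} (\<lambda>\<rho>. f_coeff f n (sqrt (s\<^sup>2 + (b - \<rho>)\<^sup>2)))"
      by (intro continuous_on_compose2[OF continuous_on_f_coeff[OF cf, of UNIV]] continuous_intros) auto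
    then show ?thesis
      unfolding coeff[OF \<sigma>] \<alpha>_def using s by (intro continuous_intros) auto
  qed
  have "g_coeff R \<mu> f n \<psi> = fourier_coeff n (\<lambda>\<phi>. integral {0..2 * b} (p 1 \<phi>) + integral {0..2 * b} (p (- 1) \<phi>))"
  proof -
    have "v_line R \<mu> f \<phi> \<psi> = integral {0..2 * b} (p 1 \<phi>) + integral {0..2 * b} (p (- 1) \<phi>)" for \<phi>
    proof -
      have "v_line R \<mu> f \<phi> \<psi> = (\<Sum>\<sigma>\<in>{1, - 1}. LBINT \<rho>:{0..}. p \<sigma> \<phi> \<rho>)"
        unfolding v_line_def p_def ..
      also have "\<dots> = (LBINT \<rho>:{0..}. p 1 \<phi> \<rho>) + (LBINT \<rho>:{0..}. p (- 1) \<phi> \<rho>)" by simp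
      finally show ?thesis by (simp only: vl insertI1 insert_iff simp_thms)
    qed
    then show ?thesis unfolding g_coeff_def by simp
  qed
  also have "\<dots> = integral {0..2 * b} (\<lambda>\<rho>. fourier_coeff n (\<lambda>\<phi>. p 1 \<phi> \<rho>)) + integral {0..2 * b} (\<lambda>\<rho>. fourier_coeff n (\<lambda>\<phi>. p (- 1) \<phi> \<rho>))"
    by (simp only: fourier_coeff_add[OF ci ci] fourier_coeff_integral[OF contp])
  also have "\<dots> = integral {0..2 * b} (\<lambda>\<rho>. fourier_coeff n (\<lambda>\<phi>. p 1 \<phi> \<rho>) + fourier_coeff n (\<lambda>\<phi>. p (- 1) \<phi> \<rho>))"
    by (intro Henstock_Kurzweil_Integration.integral_add[symmetric] integrable_continuous_interval cc) auto
  also have "\<dots> = integral {0..2 * b} (\<lambda>\<rho>. Y (b - \<rho>))"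
  proof (rule arg_cong[where f = "integral {0..2 * b}"], rule ext)
    fix \<rho>
    have ee: "exp (\<i> * of_int n * complex_of_real x) + exp (\<i> * of_int n * complex_of_real (- x)) = of_real (2 * cos (of_int n * x))" for x
      by (simp add: cos_exp_eq mult.assoc flip: cos_of_real)
    have "fourier_coeff n (\<lambda>\<phi>. p 1 \<phi> \<rho>) + fourier_coeff n (\<lambda>\<phi>. p (- 1) \<phi> \<rho>)
      = of_real (exp (- \<mu> * \<rho>)) * (exp (\<i> * of_int n * complex_of_real (\<alpha> (b - \<rho>))) + exp (\<i> * of_int n * complex_of_real (- \<alpha> (b - \<rho>))))
          * f_coeff f n (sqrt (s\<^sup>2 + (b - \<rho>)\<^sup>2))"
      by (simp add: coeff algebra_simps)
    then show "fourier_coeff n (\<lambda>\<phi>. p 1 \<phi> \<rho>) + fourier_coeff n (\<lambda>\<phi>. p (- 1) \<phi> \<rho>) = Y (b - \<rho>)"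
      unfolding ee by (simp add: Y_def)
  qed
  also have "\<dots> = integral {- b..b} Y"
    using integral_shift_real_ivl[of 0 b "2 * b" "\<lambda>\<rho>. Y (b - \<rho>)"]
      Henstock_Kurzweil_Integration.integral_reflect_real[of b "- b" Y] by simp
  also have "\<dots> = integral {- b..0} Y + integral {0..b} Y"
    using b by (intro Henstock_Kurzweil_Integration.integral_combine[symmetric] integrable_continuous_interval contY) auto
  also have "integral {- b..0} Y = integral {0..b} (\<lambda>t. Y (- t))"
    using Henstock_Kurzweil_Integration.integral_reflect_real[of b 0 "\<lambda>t. Y (- t)"] by simp
  also have "integral {0..b} (\<lambda>t. Y (- t)) + integral {0..b} Y = integral {0..b} (\<lambda>t. Y (- t) + Y t)"
    by (intro Henstock_Kurzweil_Integration.integral_add[symmetric] integrable_continuous_interval contY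
          continuous_on_compose2[OF contY[of UNIV]] continuous_intros) auto
  also have "\<dots> = integral {0..b} (\<lambda>t. 2 * complex_of_real (exp (- \<mu> * b)) *
      (f_coeff f n (sqrt (s\<^sup>2 + t\<^sup>2)) * complex_of_real (kernel_K R \<mu> n s (sqrt (s\<^sup>2 + t\<^sup>2)))))"
  proof (rule Henstock_Kurzweil_Integration.integral_cong)
    fix t assume t: "t \<in> {0..b}"
    define r where "r = sqrt (s\<^sup>2 + t\<^sup>2)"
    have r0: "0 < r" using s by (auto simp: r_def intro: add_pos_nonneg)
    have r2: "r\<^sup>2 = s\<^sup>2 + t\<^sup>2" by (simp add: r_def)
    have "s \<le> r" unfolding r_def by (intro real_le_rsqrt) simp
    have "t\<^sup>2 \<le> b\<^sup>2" using t by (intro power_mono) auto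
    then have "r \<le> R" unfolding r_def using R by (intro real_le_lsqrt) (auto simp flip: sb)
    have at: "arccos (s / r) = arctan (t / s)"
    proof -
      have "sqrt (1 + (t / s)\<^sup>2) = r / s"
      proof -
        have "1 + (t / s)\<^sup>2 = r\<^sup>2 / s\<^sup>2" using s by (simp add: r2 power_divide add_divide_distrib)
        then show ?thesis using s r0 by (simp add: real_sqrt_divide)
      qed
      then have "cos (arctan (t / s)) = s / r" by (simp add: cos_arctan)
      moreover have "0 \<le> arctan (t / s)" "arctan (t / s) \<le> pi"
        using t s by simp (use arctan_ubound[of "t / s"] pi_gt_zero in linarith)
      ultimately show ?thesis using arccos_cos[of "arctan (t / s)"] by simp
    qed
    have ab: "arccos (s / R) = pi / 2 - \<psi>"
    proof -
      have "s / R = cos (pi / 2 - \<psi>)" using R by (simp add: s_def cos_diff)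
      then show ?thesis using \<psi> arccos_cos[of "pi / 2 - \<psi>"] by simp
    qed
    have st: "sqrt (r\<^sup>2 - s\<^sup>2) = t" using t by (simp add: r2)
    have K: "kernel_K R \<mu> n s r = exp (\<mu> * t) * cos (of_int n * \<alpha> t) + exp (- \<mu> * t) * cos (of_int n * \<alpha> (- t))"
      using kernel_K_eq(1)[OF s \<open>s \<le> r\<close> \<open>r \<le> R\<close>, of \<mu> n] by (simp add: st at ab \<alpha>_def arctan_minus)
    have "exp (- \<mu> * (b - t)) = exp (- \<mu> * b) * exp (\<mu> * t)" "exp (- \<mu> * (b - - t)) = exp (- \<mu> * b) * exp (- \<mu> * t)"
      by (simp_all add: algebra_simps flip: exp_add)
    then have "Y (- t) + Y t = of_real (2 * exp (- \<mu> * b) * kernel_K R \<mu> n s r) * f_coeff f n r"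
      unfolding Y_def K by (simp add: r_def algebra_simps)
    then show "Y (- t) + Y t = 2 * complex_of_real (exp (- \<mu> * b)) *
      (f_coeff f n (sqrt (s\<^sup>2 + t\<^sup>2)) * complex_of_real (kernel_K R \<mu> n s (sqrt (s\<^sup>2 + t\<^sup>2))))"
      by (simp add: r_def mult_ac)
  qed
  also have "\<dots> = 2 * complex_of_real (exp (- \<mu> * b)) *
     integral {0..b} (\<lambda>t. f_coeff f n (sqrt (s\<^sup>2 + t\<^sup>2)) * complex_of_real (kernel_K R \<mu> n s (sqrt (s\<^sup>2 + t\<^sup>2))))"
    by (rule Henstock_Kurzweil_Integration.integral_mult_right)
  finally show ?thesis .
qed

section \<open>The integral equation along the chord\<close>

lemma real_kernel_integral:
  fixes d :: "real \<Rightarrow> real"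
  assumes s: "0 < s" "s \<le> R" and cont: "continuous_on {0..R} d"
  shows "set_integrable lborel {s..R} (\<lambda>r. d r * (r * kernel_K R \<mu> n s r / sqrt (r\<^sup>2 - s\<^sup>2)))"
    and "(LBINT r:{s..R}. d r * (r * kernel_K R \<mu> n s r / sqrt (r\<^sup>2 - s\<^sup>2)))
      = integral {0..sqrt (R\<^sup>2 - s\<^sup>2)} (\<lambda>t. d (sqrt (s\<^sup>2 + t\<^sup>2)) * kernel_K R \<mu> n s (sqrt (s\<^sup>2 + t\<^sup>2)))"
proof -
  have R: "0 < R" "s\<^sup>2 \<le> R\<^sup>2" using s by (auto intro: power_mono)
  define q where "q = (\<lambda>w. d (sqrt w) * kernel_K R \<mu> n s (sqrt w) / 2)"
  have rt: "s \<le> sqrt w \<and> sqrt w \<le> R \<and> 0 \<le> w" if "s\<^sup>2 \<le> w" "w \<le> R\<^sup>2" for w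
  proof (intro conjI)
    show "s \<le> sqrt w" using that by (intro real_le_rsqrt)
    show "sqrt w \<le> R" using that R by (intro real_le_lsqrt) (auto intro: order_trans[of _ "s\<^sup>2"])
    show "0 \<le> w" using that zero_le_power2[of s] by linarith
  qed
  have contq: "continuous_on {s\<^sup>2..R\<^sup>2} q"
  proof -
    have "continuous_on {s\<^sup>2..R\<^sup>2} (\<lambda>w. (\<lambda>(s,r). kernel_K R \<mu> n s r) (s, sqrt w))"
      by (intro continuous_on_compose2[OF continuous_on_kernel_K] continuous_intros) (use s rt in auto)
    moreover have "continuous_on {s\<^sup>2..R\<^sup>2} (\<lambda>w. d (sqrt w))"
      by (intro continuous_on_compose2[OF cont] continuous_intros) (use rt in auto)
    ultimately show ?thesis unfolding q_def by (auto intro!: continuous_intros)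
  qed
  have e: "indicator {s..R} r *\<^sub>R (d r * (r * kernel_K R \<mu> n s r / sqrt (r\<^sup>2 - s\<^sup>2)))
      = indicator {s..R} r *\<^sub>R (q (r\<^sup>2) / sqrt (r\<^sup>2 - s\<^sup>2) * (2 * r))" for r
    using s by (auto simp: q_def split: split_indicator)
  have "set_integrable lborel {s..R} (\<lambda>r. q (r\<^sup>2) / sqrt (r\<^sup>2 - s\<^sup>2) * (2 * r))"
    using set_integrable_weakly_singular[OF contq] s
    by (intro Lebesgue_Integral_Substitution.integral_substitution(1)[where f = "\<lambda>w. q w / sqrt (w - s\<^sup>2)"])
       (auto intro!: derivative_eq_intros continuous_intros simp: field_simps)
  then show "set_integrable lborel {s..R} (\<lambda>r. d r * (r * kernel_K R \<mu> n s r / sqrt (r\<^sup>2 - s\<^sup>2)))"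
    unfolding set_integrable_def e .
  have "(LBINT r:{s..R}. d r * (r * kernel_K R \<mu> n s r / sqrt (r\<^sup>2 - s\<^sup>2)))
      = (LBINT r:{s..R}. q (r\<^sup>2) / sqrt (r\<^sup>2 - s\<^sup>2) * (2 * r))"
    unfolding set_lebesgue_integral_def e ..
  also have "\<dots> = (LBINT w:{s\<^sup>2..R\<^sup>2}. q w / sqrt (w - s\<^sup>2))"
    by (rule weakly_singular_integral_radius[OF s contq, symmetric])
  also have "\<dots> = (LBINT t:{0..sqrt (R\<^sup>2 - s\<^sup>2)}. 2 * q (s\<^sup>2 + t\<^sup>2))"
    by (rule weakly_singular_integral_chord[OF R(2) contq])
  also have "\<dots> = integral {0..sqrt (R\<^sup>2 - s\<^sup>2)} (\<lambda>t. 2 * q (s\<^sup>2 + t\<^sup>2))"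
  proof (intro set_borel_integral_eq_integral borel_integrable_atLeastAtMost' continuous_intros
      continuous_on_compose2[OF contq])
    have "t\<^sup>2 \<le> R\<^sup>2 - s\<^sup>2" if "t \<in> {0..sqrt (R\<^sup>2 - s\<^sup>2)}" for t
      using that R power_mono[of t "sqrt (R\<^sup>2 - s\<^sup>2)" 2] by simp
    then show "(\<lambda>t. s\<^sup>2 + t\<^sup>2) ` {0..sqrt (R\<^sup>2 - s\<^sup>2)} \<subseteq> {s\<^sup>2..R\<^sup>2}" by fastforce
  qed
  finally show "(LBINT r:{s..R}. d r * (r * kernel_K R \<mu> n s r / sqrt (r\<^sup>2 - s\<^sup>2)))
      = integral {0..sqrt (R\<^sup>2 - s\<^sup>2)} (\<lambda>t. d (sqrt (s\<^sup>2 + t\<^sup>2)) * kernel_K R \<mu> n s (sqrt (s\<^sup>2 + t\<^sup>2)))"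
    by (simp add: q_def)
qed

lemma complex_kernel_integral_Re_Im:
  fixes h :: "real \<Rightarrow> complex" and R \<mu> s :: real and n :: int
  assumes s: "0 < s" "s \<le> R" and cont: "continuous_on {0..R} h"
  defines "I \<equiv> (LBINT r:{s..R}. h r * complex_of_real (r * kernel_K R \<mu> n s r / sqrt (r\<^sup>2 - s\<^sup>2)))"
  shows "Re I = (LBINT r:{s..R}. Re (h r) * (r * kernel_K R \<mu> n s r / sqrt (r\<^sup>2 - s\<^sup>2)))"
    and "Im I = (LBINT r:{s..R}. Im (h r) * (r * kernel_K R \<mu> n s r / sqrt (r\<^sup>2 - s\<^sup>2)))"
proof -
  define wt where "wt = (\<lambda>r. r * kernel_K R \<mu> n s r / sqrt (r\<^sup>2 - s\<^sup>2))"
  have c: "continuous_on {0..R} (\<lambda>r. Re (h r))" "continuous_on {0..R} (\<lambda>r. Im (h r))"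
    by (intro continuous_intros cont)+
  have i: "set_integrable lborel {s..R} (\<lambda>r. Re (h r) * wt r)" "set_integrable lborel {s..R} (\<lambda>r. Im (h r) * wt r)"
    using real_kernel_integral(1)[OF s c(1), of \<mu> n] real_kernel_integral(1)[OF s c(2), of \<mu> n]
    by (simp_all add: wt_def)
  have ci: "set_integrable lborel {s..R} (\<lambda>r. complex_of_real (g r))" if "set_integrable lborel {s..R} g" for g
    using integrable_of_real[OF that[unfolded set_integrable_def], where 'a = complex]
    by (simp add: set_integrable_def scaleR_conv_of_real)
  have "h r * complex_of_real (wt r) = complex_of_real (Re (h r) * wt r) + \<i> * complex_of_real (Im (h r) * wt r)" for r
    by (simp add: complex_eq_iff)
  then have "I = (LBINT r:{s..R}. complex_of_real (Re (h r) * wt r) + \<i> * complex_of_real (Im (h r) * wt r))"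
    by (simp add: I_def wt_def)
  also have "\<dots> = (LBINT r:{s..R}. complex_of_real (Re (h r) * wt r)) + (LBINT r:{s..R}. \<i> * complex_of_real (Im (h r) * wt r))"
    by (intro set_integral_add set_integrable_mult_right ci i)
  also have "\<dots> = of_real (LBINT r:{s..R}. Re (h r) * wt r) + \<i> * of_real (LBINT r:{s..R}. Im (h r) * wt r)"
    by (simp only: set_integral_mult_right set_integral_complex_of_real)
  finally have I: "I = of_real (LBINT r:{s..R}. Re (h r) * wt r) + \<i> * of_real (LBINT r:{s..R}. Im (h r) * wt r)" .
  have "Re I = (LBINT r:{s..R}. Re (h r) * wt r)" "Im I = (LBINT r:{s..R}. Im (h r) * wt r)"
    by (subst I, simp)+
  then show "Re I = (LBINT r:{s..R}. Re (h r) * (r * kernel_K R \<mu> n s r / sqrt (r\<^sup>2 - s\<^sup>2)))"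
    and "Im I = (LBINT r:{s..R}. Im (h r) * (r * kernel_K R \<mu> n s r / sqrt (r\<^sup>2 - s\<^sup>2)))"
    unfolding wt_def .
qed

lemma complex_kernel_integral_chord:
  fixes h :: "real \<Rightarrow> complex"
  assumes s: "0 < s" "s \<le> R" and cont: "continuous_on {0..R} h"
  shows "(LBINT r:{s..R}. h r * complex_of_real (r * kernel_K R \<mu> n s r / sqrt (r\<^sup>2 - s\<^sup>2)))
    = integral {0..sqrt (R\<^sup>2 - s\<^sup>2)} (\<lambda>t. h (sqrt (s\<^sup>2 + t\<^sup>2)) * complex_of_real (kernel_K R \<mu> n s (sqrt (s\<^sup>2 + t\<^sup>2))))"
    (is "_ = integral ?T ?g")
proof -
  have c: "continuous_on {0..R} (\<lambda>r. Re (h r))" "continuous_on {0..R} (\<lambda>r. Im (h r))"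
    by (intro continuous_intros cont)+
  have R: "0 < R" "s\<^sup>2 \<le> R\<^sup>2" using s by (auto intro: power_mono)
  have rt: "s \<le> sqrt (s\<^sup>2 + t\<^sup>2) \<and> sqrt (s\<^sup>2 + t\<^sup>2) \<le> R" if "t \<in> ?T" for t
  proof
    show "s \<le> sqrt (s\<^sup>2 + t\<^sup>2)" by (intro real_le_rsqrt) simp
    have "t\<^sup>2 \<le> R\<^sup>2 - s\<^sup>2" using that R power_mono[of t "sqrt (R\<^sup>2 - s\<^sup>2)" 2] by simp
    then show "sqrt (s\<^sup>2 + t\<^sup>2) \<le> R" using R by (intro real_le_lsqrt) auto
  qed
  have "continuous_on ?T (\<lambda>t. (\<lambda>(s,r). kernel_K R \<mu> n s r) (s, sqrt (s\<^sup>2 + t\<^sup>2)))"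
    by (intro continuous_on_compose2[OF continuous_on_kernel_K] continuous_intros) (use s rt in auto)
  moreover have "continuous_on ?T (\<lambda>t. h (sqrt (s\<^sup>2 + t\<^sup>2)))"
    by (intro continuous_on_compose2[OF cont] continuous_intros) (use s rt in auto)
  ultimately have "continuous_on ?T ?g" by (auto intro!: continuous_intros)
  then have gi: "?g integrable_on ?T" by (rule integrable_continuous_interval)
  have "Re (integral ?T ?g) = integral ?T (\<lambda>t. Re (h (sqrt (s\<^sup>2 + t\<^sup>2))) * kernel_K R \<mu> n s (sqrt (s\<^sup>2 + t\<^sup>2)))"
    and "Im (integral ?T ?g) = integral ?T (\<lambda>t. Im (h (sqrt (s\<^sup>2 + t\<^sup>2))) * kernel_K R \<mu> n s (sqrt (s\<^sup>2 + t\<^sup>2)))"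
    using integral_linear[OF gi bounded_linear_Re] integral_linear[OF gi bounded_linear_Im] by (simp_all add: o_def)
  then show ?thesis
    by (intro complex_eqI)
       (simp_all only: complex_kernel_integral_Re_Im[OF s cont] real_kernel_integral(2)[OF s c(1)]
          real_kernel_integral(2)[OF s c(2)])
qed

section \<open>Existence and uniqueness\<close>

theorem theorem3p2:
  fixes R \<mu> :: real and f :: "real ^ 2 \<Rightarrow> real" and n :: int
  assumes "R > 0" and "\<mu> * R \<le> 3 / 2" and "f \<in> Cc_inf_disc R"
  shows "(continuous_on {0..R} (f_coeff f n) \<and>
          solves_integral_eq R \<mu> n (g_coeff R \<mu> f n) (f_coeff f n)) \<and>
         (\<forall>h. continuous_on {0..R} h \<and> solves_integral_eq R \<mu> n (g_coeff R \<mu> f n) h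
              \<longrightarrow> (\<forall>r\<in>{0..R}. h r = f_coeff f n r))"
proof (intro conjI allI impI ballI)
  show cont: "continuous_on {0..R} (f_coeff f n)"
    by (rule continuous_on_f_coeff[OF Cc_inf_disc_continuous[OF assms(3)]])
  define J where "J = (\<lambda>h s. LBINT r:{s..R}. h r * complex_of_real (r * kernel_K R \<mu> n s r / sqrt (r\<^sup>2 - s\<^sup>2)))"
  have solves_iff: "solves_integral_eq R \<mu> n g h \<longleftrightarrow> (\<forall>\<psi>\<in>{0<..<pi/2}.
      g \<psi> = 2 * complex_of_real (exp (- \<mu> * R * cos \<psi>)) * J h (R * sin \<psi>))" for g h
    by (simp add: solves_integral_eq_def J_def power_mult_distrib)
  show sol: "solves_integral_eq R \<mu> n (g_coeff R \<mu> f n) (f_coeff f n)"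
    unfolding solves_iff
  proof
    fix \<psi> :: real assume \<psi>: "\<psi> \<in> {0<..<pi/2}"
    have p: "0 < sin \<psi>" "0 < cos \<psi>" using \<psi> by (auto intro: sin_gt_zero cos_gt_zero)
    have "R\<^sup>2 - (R * sin \<psi>)\<^sup>2 = (R * cos \<psi>)\<^sup>2"
      by (simp add: power_mult_distrib cos_squared_eq right_diff_distrib)
    then have b: "sqrt (R\<^sup>2 - (R * sin \<psi>)\<^sup>2) = R * cos \<psi>" using assms(1) p by simp
    have s: "0 < R * sin \<psi>" "R * sin \<psi> \<le> R" using assms(1) p by auto
    show "g_coeff R \<mu> f n \<psi> = 2 * complex_of_real (exp (- \<mu> * R * cos \<psi>)) * J (f_coeff f n) (R * sin \<psi>)"
      unfolding J_def complex_kernel_integral_chord[OF s cont] b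
      using g_coeff_chord_integral[OF assms(1,3) \<psi>, of \<mu> n] by (simp add: mult.assoc)
  qed
  fix h :: "real \<Rightarrow> complex" and r :: real
  assume h: "continuous_on {0..R} h \<and> solves_integral_eq R \<mu> n (g_coeff R \<mu> f n) h" and r: "r \<in> {0..R}"
  then have conth: "continuous_on {0..R} h" by blast
  have J_eq: "J h s = J (f_coeff f n) s" if s: "0 < s" "s < R" for s
  proof -
    define \<psi> where "\<psi> = arcsin (s / R)"
    have q: "0 < s / R" "s / R < 1" using s by auto
    have "\<psi> \<in> {0<..<pi/2}"
      using arcsin_less_arcsin[of 0 "s / R"] arcsin_less_arcsin[of "s / R" 1] q by (auto simp: \<psi>_def)
    moreover have "sin \<psi> = s / R" unfolding \<psi>_def using q by (intro sin_arcsin) auto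
    then have "R * sin \<psi> = s" using s by simp
    ultimately have "2 * complex_of_real (exp (- \<mu> * R * cos \<psi>)) * J h s
        = 2 * complex_of_real (exp (- \<mu> * R * cos \<psi>)) * J (f_coeff f n) s"
      using h sol unfolding solves_iff by metis
    then show ?thesis by simp
  qed
  \<comment> \<open>\<open>L\<close> is the real or the imaginary part, so that the uniqueness result for real functions applies.\<close>
  have part: "L (h r) - L (f_coeff f n r) = 0"
    if L: "\<And>g. continuous_on {0..R} g \<Longrightarrow> continuous_on {0..R} (\<lambda>x. L (g x))"
      and LJ: "\<And>g s. 0 < s \<Longrightarrow> s < R \<Longrightarrow> continuous_on {0..R} g \<Longrightarrow>
        L (J g s) = (LBINT r:{s..R}. L (g r) * (r * kernel_K R \<mu> n s r / sqrt (r\<^sup>2 - s\<^sup>2)))"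
    for L :: "complex \<Rightarrow> real"
  proof (rule homogeneous_equation_uniqueness[OF assms(1,2) _ _ r])
    show "continuous_on {0..R} (\<lambda>r. L (h r) - L (f_coeff f n r))"
      by (intro continuous_intros L conth cont)
    fix s assume s: "0 < s" "s < R"
    define wt where "wt = (\<lambda>r. r * kernel_K R \<mu> n s r / sqrt (r\<^sup>2 - s\<^sup>2))"
    have i: "set_integrable lborel {s..R} (\<lambda>r. L (g r) * wt r)" if "continuous_on {0..R} g" for g
      unfolding wt_def using s by (intro real_kernel_integral(1) L that) auto
    have "(LBINT r:{s..R}. (L (h r) - L (f_coeff f n r)) * wt r)
        = (LBINT r:{s..R}. L (h r) * wt r - L (f_coeff f n r) * wt r)"
      by (simp add: left_diff_distrib)
    also have "\<dots> = (LBINT r:{s..R}. L (h r) * wt r) - (LBINT r:{s..R}. L (f_coeff f n r) * wt r)"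
      by (intro set_integral_diff i conth cont)
    also have "\<dots> = L (J h s) - L (J (f_coeff f n) s)"
      using LJ[OF s conth] LJ[OF s cont] by (simp add: wt_def)
    finally show "(LBINT r:{s..R}. (L (h r) - L (f_coeff f n r)) * (r * kernel_K R \<mu> n s r / sqrt (r\<^sup>2 - s\<^sup>2))) = 0"
      using J_eq[OF s] by (simp add: wt_def)
  qed
  have "Re (h r) - Re (f_coeff f n r) = 0"
  proof (rule part)
    show "Re (J g s) = (LBINT r:{s..R}. Re (g r) * (r * kernel_K R \<mu> n s r / sqrt (r\<^sup>2 - s\<^sup>2)))"
      if "0 < s" "s < R" "continuous_on {0..R} g" for g s
      unfolding J_def by (rule complex_kernel_integral_Re_Im(1)) (use that in auto)
  qed (intro continuous_intros)
  moreover have "Im (h r) - Im (f_coeff f n r) = 0"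
  proof (rule part)
    show "Im (J g s) = (LBINT r:{s..R}. Im (g r) * (r * kernel_K R \<mu> n s r / sqrt (r\<^sup>2 - s\<^sup>2)))"
      if "0 < s" "s < R" "continuous_on {0..R} g" for g s
      unfolding J_def by (rule complex_kernel_integral_Re_Im(2)) (use that in auto)
  qed (intro continuous_intros)
  ultimately show "h r = f_coeff f n r" by (simp add: complex_eq_iff)
qed

end
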